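(* Let $V_0,V_1,V_2$ be three polarized super Hilbert spaces and let $L_{01}\subset\Pi V_0\oplus V_1$ and $L_{12}\subset\Pi V_1\oplus V_2$ be two split Lagrangians. Then the composition $L_{12}\circ L_{01}$ is a Lagrangian in $\Pi V_0\oplus V_2$, which is again split.
   Context: A super Hilbert space is a (real or complex) Hilbert space $V$ with an orthogonal decomposition $V=V^+\oplus V^-$; its grading operator $\Gamma$ is $\pm1$ on $V^\pm$, and $B(x,y)=\langle\Gamma x,y\rangle$. A subspace $L$ is $B$-isotropic if $B$ vanishes on $L\times L$. A sub-Lagrangian is a closed $B$-isotropic subspace $L$ such that $L+\Gamma L$ has finite codimension in $V$; a Lagrangian is a $B$-isotropic subspace with $L+\Gamma L=V$. $\Pi V$ is the same Hilbert space with grading operator $-\Gamma$. Two closed subspaces $U,\tilde U$ of a Hilbert space are close if the difference $P_U-P_{\tilde U}$ of the orthogonal projections is Hilbert--Schmidt; this is an equivalence relation. A polarized super Hilbert space is a super Hilbert space $V$ with a distinguished closeness class $[L]$ of sub-Lagrangians. If $V_0,V_1$ are polarized by $[L_0],[L_1]$, a Lagrangian $L\subset\Pi V_0\oplus V_1$ is split if it is close to $L_0^\perp\oplus L_1$ for some (hence any) sub-Lagrangians $L_i$ representing the polarization of $V_i$. The composition is $$L_{12}\circ L_{01}=\{(x_0,x_2)\mid\exists x_1\in V_1:(x_0,x_1)\in L_{01},\ (x_1,x_2)\in L_{12}\}.$$ *)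

theory Defs
  imports "HOL-Analysis.Analysis"
begin

section \<open>Scalars\<close>

text \<open>
  The axioms make every element a root of the real polynomial
  \<open>t^2 - 2 Re(z) t + |z|^2\<close>, so that, up to isomorphism, the only instances are the real and the
  complex numbers with their usual conjugation, real part and absolute value.
\<close>

class real_or_complex = real_normed_field +
  fixes conj_scalar :: "'a \<Rightarrow> 'a"
    and Re_scalar :: "'a \<Rightarrow> real"
  assumes conj_scalar_add: "conj_scalar (x + y) = conj_scalar x + conj_scalar y"
    and conj_scalar_mult: "conj_scalar (x * y) = conj_scalar x * conj_scalar y"
    and conj_scalar_conj_scalar: "conj_scalar (conj_scalar x) = x"
    and add_conj_scalar: "x + conj_scalar x = (2 * Re_scalar x) *\<^sub>R 1"
    and mult_conj_scalar: "x * conj_scalar x = (norm x)\<^sup>2 *\<^sub>R 1"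

instantiation real :: real_or_complex
begin

definition conj_scalar_real :: "real \<Rightarrow> real" where "conj_scalar_real x = x"

definition Re_scalar_real :: "real \<Rightarrow> real" where "Re_scalar_real x = x"

instance
  by standard (simp_all add: conj_scalar_real_def Re_scalar_real_def power2_eq_square)

end

instantiation complex :: real_or_complex
begin

definition conj_scalar_complex :: "complex \<Rightarrow> complex" where "conj_scalar_complex = cnj"

definition Re_scalar_complex :: "complex \<Rightarrow> real" where "Re_scalar_complex = Re"

instance
  by standard
    (simp_all add: conj_scalar_complex_def Re_scalar_complex_def complex_add_cnj
      complex_norm_square [symmetric] scaleR_conv_of_real)

end


section \<open>Super Hilbert spaces\<close>

text \<open>
  The underlying Hilbert space is a whole type. Its norm, topology and completeness are those of
  the type; the scalar multiplication, the scalar-valued inner product and the grading operator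
  are carried explicitly, so that real and complex spaces are treated uniformly.
\<close>

record ('k, 'v) super_space =
  scl :: "'k \<Rightarrow> 'v \<Rightarrow> 'v"
  ip :: "'v \<Rightarrow> 'v \<Rightarrow> 'k"
  grading :: "'v \<Rightarrow> 'v"

text \<open>
  The real inner product of the type is the real part of \<^term>\<open>ip V\<close>; together with conjugate
  symmetry this says that \<^term>\<open>ip V x x\<close> is the square of the norm of \<^term>\<open>x\<close>.
\<close>

definition hilbert_space ::
    "('k::real_or_complex, 'v::{real_inner, complete_space}) super_space \<Rightarrow> bool" where
  "hilbert_space V \<longleftrightarrow>
     vector_space (scl V) \<and>
     (\<forall>r x. scl V (of_real r) x = r *\<^sub>R x) \<and>
     (\<forall>x y z. ip V (x + y) z = ip V x z + ip V y z) \<and>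
     (\<forall>c x y. ip V (scl V c x) y = c * ip V x y) \<and>
     (\<forall>x y. ip V y x = conj_scalar (ip V x y)) \<and>
     (\<forall>x y. Re_scalar (ip V x y) = inner x y)"

definition lin_subspace ::
    "('k::real_or_complex, 'v::{real_inner, complete_space}) super_space \<Rightarrow> 'v set \<Rightarrow> bool" where
  "lin_subspace V U \<longleftrightarrow> module.subspace (scl V) U"

definition lin_span ::
    "('k::real_or_complex, 'v::{real_inner, complete_space}) super_space \<Rightarrow> 'v set \<Rightarrow> 'v set" where
  "lin_span V S = module.span (scl V) S"

definition subspace_sum :: "'v::plus set \<Rightarrow> 'v set \<Rightarrow> 'v set" where
  "subspace_sum A B = {x + y | x y. x \<in> A \<and> y \<in> B}"

definition even_part :: "('k, 'v::real_inner) super_space \<Rightarrow> 'v set" where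
  "even_part V = {x. grading V x = x}"

definition odd_part :: "('k, 'v::real_inner) super_space \<Rightarrow> 'v set" where
  "odd_part V = {x. grading V x = - x}"

text \<open>
  The orthogonal decomposition is encoded by its grading operator, whose eigenspaces recover the
  two summands.
\<close>

definition super_hilbert_space ::
    "('k::real_or_complex, 'v::{real_inner, complete_space}) super_space \<Rightarrow> bool" where
  "super_hilbert_space V \<longleftrightarrow>
     hilbert_space V \<and>
     lin_subspace V (even_part V) \<and> lin_subspace V (odd_part V) \<and>
     (\<forall>x\<in>even_part V. \<forall>y\<in>odd_part V. ip V x y = 0) \<and>
     subspace_sum (even_part V) (odd_part V) = UNIV \<and>
     (\<forall>x\<in>even_part V. \<forall>y\<in>odd_part V. grading V (x + y) = x - y)"

definition grading_form :: "('k, 'v) super_space \<Rightarrow> 'v \<Rightarrow> 'v \<Rightarrow> 'k" where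
  "grading_form V x y = ip V (grading V x) y"

definition parity :: "('k, 'v::real_inner) super_space \<Rightarrow> ('k, 'v) super_space" where
  "parity V = V\<lparr>grading := (\<lambda>x. - grading V x)\<rparr>"

definition direct_sum ::
    "('k::real_or_complex, 'v) super_space \<Rightarrow> ('k, 'w) super_space \<Rightarrow> ('k, 'v \<times> 'w) super_space" where
  "direct_sum V W =
     \<lparr>scl = (\<lambda>c (x, y). (scl V c x, scl W c y)),
      ip = (\<lambda>(x, y) (x', y'). ip V x x' + ip W y y'),
      grading = (\<lambda>(x, y). (grading V x, grading W y))\<rparr>"


lemma hilbert_space_real:
  "hilbert_space \<lparr>scl = scaleR, ip = inner, grading = (G :: 'v \<Rightarrow> 'v::{real_inner, complete_space})\<rparr>"
  unfolding hilbert_space_def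
  by (auto simp: conj_scalar_real_def Re_scalar_real_def inner_commute inner_add_left inner_add_right
      intro: real_vector.vector_space_axioms)

lemma hilbert_space_complex:
  "hilbert_space \<lparr>scl = (*), ip = (\<lambda>x y. x * cnj y), grading = (G :: complex \<Rightarrow> complex)\<rparr>"
  unfolding hilbert_space_def
  by (auto simp: conj_scalar_complex_def Re_scalar_complex_def scaleR_conv_of_real inner_complex_def
      algebra_simps vector_space_def)

lemma conj_scalar_zero [simp]: "conj_scalar (0 :: 'k::real_or_complex) = 0"
  using conj_scalar_add [of "0 :: 'k" 0] by simp

lemma Re_scalar_add: "Re_scalar (x + y) = Re_scalar x + Re_scalar (y :: 'k::real_or_complex)"
proof -
  have "of_real (2 * Re_scalar (x + y)) = (of_real (2 * Re_scalar x + 2 * Re_scalar y) :: 'k)"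
  proof -
    have "of_real (2 * Re_scalar x + 2 * Re_scalar y) = (x + conj_scalar x) + (y + conj_scalar y)"
      by (simp only: add_conj_scalar of_real_add scaleR_conv_of_real mult_1_right)
    also have "\<dots> = (x + y) + conj_scalar (x + y)"
      by (simp add: conj_scalar_add)
    also have "\<dots> = of_real (2 * Re_scalar (x + y))"
      by (simp only: add_conj_scalar scaleR_conv_of_real mult_1_right)
    finally show ?thesis by simp
  qed
  then show ?thesis unfolding of_real_eq_iff by simp
qed

lemma hilbert_spaceD:
  assumes "hilbert_space V"
  shows "vector_space (scl V)"
    and "scl V (of_real r) x = r *\<^sub>R x"
    and "ip V (x + y) z = ip V x z + ip V y z"
    and "ip V (scl V c x) y = c * ip V x y"
    and "ip V y x = conj_scalar (ip V x y)"
    and "Re_scalar (ip V x y) = inner x y"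
  using assms unfolding hilbert_space_def by blast+

lemma hilbert_space_direct_sum:
  assumes "hilbert_space V" "hilbert_space W"
  shows "hilbert_space (direct_sum V W)"
proof -
  note V = hilbert_spaceD [OF assms(1)] and W = hilbert_spaceD [OF assms(2)]
  let ?S = "direct_sum V W"
  have "vector_space (scl ?S)"
    using V(1) W(1) by (simp add: direct_sum_def vector_space_def split_beta)
  moreover have "scl ?S (of_real r) x = r *\<^sub>R x" for r x
    by (cases x) (simp add: direct_sum_def V(2) W(2))
  moreover have "ip ?S (x + y) z = ip ?S x z + ip ?S y z" for x y z
    by (simp add: direct_sum_def split_beta V(3) W(3))
  moreover have "ip ?S (scl ?S c x) y = c * ip ?S x y" for c x y
    by (simp add: direct_sum_def split_beta V(4) W(4) distrib_left)
  moreover have "ip ?S y x = conj_scalar (ip ?S x y)" for x y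
    using V(5) [of "fst y" "fst x"] W(5) [of "snd y" "snd x"]
    by (simp add: direct_sum_def split_beta conj_scalar_add)
  moreover have "Re_scalar (ip ?S x y) = inner x y" for x y
    by (simp add: direct_sum_def split_beta Re_scalar_add inner_prod_def V(6) W(6))
  ultimately show ?thesis unfolding hilbert_space_def by blast
qed

lemma super_hilbert_space_parity:
  assumes "super_hilbert_space V"
  shows "super_hilbert_space (parity V)"
proof -
  have eo: "even_part (parity V) = odd_part V" "odd_part (parity V) = even_part V"
    by (auto simp: even_part_def odd_part_def parity_def minus_equation_iff)
  have sum: "subspace_sum (odd_part V) (even_part V) = subspace_sum (even_part V) (odd_part V)"
    by (force simp: subspace_sum_def add.commute)
  have ip: "ip V y x = 0" if "ip V x y = 0" for x y
    using assms that hilbert_spaceD(5) [of V y x] by (simp add: super_hilbert_space_def)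
  have g: "- grading V (x + y) = x - y" if "x \<in> odd_part V" "y \<in> even_part V" for x y
  proof -
    have "grading V (y + x) = y - x"
      using assms that unfolding super_hilbert_space_def by blast
    then show ?thesis by (simp add: add.commute)
  qed
  have "scl (parity V) = scl V" "ip (parity V) = ip V"
    by (simp_all add: parity_def)
  then have "hilbert_space (parity V) = hilbert_space V"
    unfolding hilbert_space_def by (simp only:)
  moreover have "lin_subspace (parity V) U = lin_subspace V U" for U
    by (simp add: lin_subspace_def parity_def)
  moreover have "ip (parity V) x y = ip V x y" "grading (parity V) x = - grading V x" for x y
    by (simp_all add: parity_def)
  ultimately show ?thesis
    using assms unfolding super_hilbert_space_def eo sum by (auto simp only: intro: ip g)
qed

lemma super_hilbert_space_direct_sum:
  fixes V :: "('k::real_or_complex, 'v::{real_inner, complete_space}) super_space"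
    and W :: "('k, 'w::{real_inner, complete_space}) super_space"
  assumes "super_hilbert_space V" "super_hilbert_space W"
  shows "super_hilbert_space (direct_sum V W)"
proof -
  have eo: "even_part (direct_sum V W) = even_part V \<times> even_part W"
    "odd_part (direct_sum V W) = odd_part V \<times> odd_part W"
    by (auto simp: even_part_def odd_part_def direct_sum_def)
  have H: "hilbert_space V" "hilbert_space W" "hilbert_space (direct_sum V W)"
    using assms hilbert_space_direct_sum by (auto simp: super_hilbert_space_def)
  have m: "module (scl V)" "module (scl W)" "module (scl (direct_sum V W))"
    using H [THEN hilbert_spaceD(1)] by (simp_all add: module_iff_vector_space)
  have sub: "lin_subspace (direct_sum V W) (A \<times> B)"
    if "lin_subspace V A" "lin_subspace W B" for A B
    using that m unfolding lin_subspace_def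
    by (auto simp: module.subspace_def zero_prod_def direct_sum_def)
  have sum: "subspace_sum (A \<times> B) (C \<times> D) = UNIV"
    if "subspace_sum A C = UNIV" "subspace_sum B D = UNIV" for A C :: "'v set" and B D :: "'w set"
  proof -
    have "(x, y) \<in> subspace_sum (A \<times> B) (C \<times> D)" for x y
    proof -
      have "x \<in> subspace_sum A C" "y \<in> subspace_sum B D" using that by auto
      then show ?thesis unfolding subspace_sum_def by force
    qed
    then show ?thesis by auto
  qed
  have "subspace_sum (even_part (direct_sum V W)) (odd_part (direct_sum V W)) = UNIV"
    unfolding eo using assms by (intro sum) (auto simp: super_hilbert_space_def)
  moreover have "lin_subspace (direct_sum V W) (even_part (direct_sum V W))"
    "lin_subspace (direct_sum V W) (odd_part (direct_sum V W))"
    unfolding eo using assms by (auto intro!: sub simp: super_hilbert_space_def)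
  moreover have "\<forall>x\<in>even_part (direct_sum V W). \<forall>y\<in>odd_part (direct_sum V W).
      ip (direct_sum V W) x y = 0 \<and> grading (direct_sum V W) (x + y) = x - y"
    using assms unfolding eo by (simp add: super_hilbert_space_def direct_sum_def)
  ultimately show ?thesis
    using H(3) by (simp add: super_hilbert_space_def)
qed

section \<open>Lagrangians\<close>

definition isotropic :: "('k::zero, 'v) super_space \<Rightarrow> 'v set \<Rightarrow> bool" where
  "isotropic V L \<longleftrightarrow> (\<forall>x\<in>L. \<forall>y\<in>L. grading_form V x y = 0)"

definition finite_codim ::
    "('k::real_or_complex, 'v::{real_inner, complete_space}) super_space \<Rightarrow> 'v set \<Rightarrow> bool" where
  "finite_codim V U \<longleftrightarrow> (\<exists>F. finite F \<and> subspace_sum U (lin_span V F) = UNIV)"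

definition sub_lagrangian ::
    "('k::real_or_complex, 'v::{real_inner, complete_space}) super_space \<Rightarrow> 'v set \<Rightarrow> bool" where
  "sub_lagrangian V L \<longleftrightarrow>
     lin_subspace V L \<and> closed L \<and> isotropic V L \<and>
     finite_codim V (subspace_sum L (grading V ` L))"

definition lagrangian ::
    "('k::real_or_complex, 'v::{real_inner, complete_space}) super_space \<Rightarrow> 'v set \<Rightarrow> bool" where
  "lagrangian V L \<longleftrightarrow>
     lin_subspace V L \<and> isotropic V L \<and> subspace_sum L (grading V ` L) = UNIV"


section \<open>Closeness\<close>

definition orth_compl :: "('k::zero, 'v) super_space \<Rightarrow> 'v set \<Rightarrow> 'v set" where
  "orth_compl V U = {x. \<forall>u\<in>U. ip V x u = 0}"

definition orth_proj :: "('k::zero, 'v::real_inner) super_space \<Rightarrow> 'v set \<Rightarrow> 'v \<Rightarrow> 'v" where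
  "orth_proj V U x = (THE p. p \<in> U \<and> x - p \<in> orth_compl V U)"

definition orthonormal_basis ::
    "('k::real_or_complex, 'v::{real_inner, complete_space}) super_space \<Rightarrow> 'v set \<Rightarrow> bool" where
  "orthonormal_basis V E \<longleftrightarrow>
     (\<forall>e\<in>E. \<forall>f\<in>E. ip V e f = (if e = f then 1 else 0)) \<and>
     closure (lin_span V E) = UNIV"

text \<open>
  No separability is assumed, so the orthonormal basis may be uncountable. The value of the sum
  does not depend on its choice, and an orthonormal basis always exists.
\<close>

definition hilbert_schmidt ::
    "('k::real_or_complex, 'v::{real_inner, complete_space}) super_space \<Rightarrow> ('v \<Rightarrow> 'v) \<Rightarrow> bool" where
  "hilbert_schmidt V T \<longleftrightarrow>
     Vector_Spaces.linear (scl V) (scl V) T \<and> bounded_linear T \<and>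
     (\<exists>E. orthonormal_basis V E \<and> (\<lambda>e. (norm (T e))\<^sup>2) summable_on E)"

definition close ::
    "('k::real_or_complex, 'v::{real_inner, complete_space}) super_space \<Rightarrow>
     'v set \<Rightarrow> 'v set \<Rightarrow> bool" where
  "close V U U' \<longleftrightarrow>
     lin_subspace V U \<and> closed U \<and> lin_subspace V U' \<and> closed U' \<and>
     hilbert_schmidt V (\<lambda>x. orth_proj V U x - orth_proj V U' x)"


section \<open>Polarizations and split Lagrangians\<close>

definition polarized ::
    "('k::real_or_complex, 'v::{real_inner, complete_space}) super_space \<Rightarrow> 'v set set \<Rightarrow> bool" where
  "polarized V P \<longleftrightarrow>
     super_hilbert_space V \<and>
     (\<exists>L. sub_lagrangian V L \<and> P = {L'. sub_lagrangian V L' \<and> close V L L'})"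

definition split_lagrangian ::
    "('k::real_or_complex, 'v::{real_inner, complete_space}) super_space \<Rightarrow> 'v set set \<Rightarrow>
     ('k, 'w::{real_inner, complete_space}) super_space \<Rightarrow> 'w set set \<Rightarrow> ('v \<times> 'w) set \<Rightarrow> bool" where
  "split_lagrangian V\<^sub>0 P\<^sub>0 V\<^sub>1 P\<^sub>1 L \<longleftrightarrow>
     lagrangian (direct_sum (parity V\<^sub>0) V\<^sub>1) L \<and>
     (\<exists>L\<^sub>0\<in>P\<^sub>0. \<exists>L\<^sub>1\<in>P\<^sub>1.
        close (direct_sum (parity V\<^sub>0) V\<^sub>1) L (orth_compl V\<^sub>0 L\<^sub>0 \<times> L\<^sub>1))"

text \<open>
  As a set of pairs, the composition of \<open>L\<^sub>0\<^sub>1\<close> followed by \<open>L\<^sub>1\<^sub>2\<close> is the relational composition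
  \<open>L\<^sub>0\<^sub>1 O L\<^sub>1\<^sub>2\<close>; mathematical notation lists the factors in the opposite order.
\<close>

definition lagr_comp :: "('v \<times> 'w) set \<Rightarrow> ('u \<times> 'v) set \<Rightarrow> ('u \<times> 'w) set" where
  "lagr_comp L\<^sub>1\<^sub>2 L\<^sub>0\<^sub>1 = L\<^sub>0\<^sub>1 O L\<^sub>1\<^sub>2"

lemma lagr_comp_eq:
  "lagr_comp L\<^sub>1\<^sub>2 L\<^sub>0\<^sub>1 = {(x\<^sub>0, x\<^sub>2). \<exists>x\<^sub>1. (x\<^sub>0, x\<^sub>1) \<in> L\<^sub>0\<^sub>1 \<and> (x\<^sub>1, x\<^sub>2) \<in> L\<^sub>1\<^sub>2}"
  by (auto simp: lagr_comp_def)

end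

theory Submission
  imports Defs
begin

text \<open>
  Lagrangians are the subspaces with \<open>L = (\<Gamma> L)\<^sup>\<perp>\<close>, a condition on the underlying real Hilbert space.
  Let \<open>D\<close> map \<open>((x\<^sub>0, x\<^sub>1), (y\<^sub>1, x\<^sub>2))\<close> in \<open>L\<^sub>0\<^sub>1 \<times> L\<^sub>1\<^sub>2\<close> to \<open>(x\<^sub>0, x\<^sub>1 - y\<^sub>1, x\<^sub>2)\<close>. Splitness controls the
  \<open>K\<^sub>1\<^sup>\<perp>\<close>-component of \<open>x\<^sub>1\<close> and the \<open>K\<^sub>1\<close>-component of \<open>y\<^sub>1\<close>, where \<open>K\<^sub>1\<close> represents the polarization of
  \<open>V\<^sub>1\<close>, by Hilbert--Schmidt operators, which are small off a finite-dimensional space. So \<open>D\<close> is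
  bounded below on a subspace of finite codimension; its range is closed and it has a bounded section
  there. Closedness gives \<open>U = (\<Gamma> U)\<^sup>\<perp>\<close> for the composition \<open>U\<close> by duality. The section chooses \<open>x\<^sub>1\<close>
  boundedly in terms of \<open>(x\<^sub>0, x\<^sub>2) \<in> U\<close>, so with \<open>M = K\<^sub>0\<^sup>\<perp> \<times> K\<^sub>2\<close> the operator \<open>(1 - P\<^sub>M) P\<^sub>U\<close> is
  Hilbert--Schmidt. Since \<open>1 - P\<^sub>U = \<Gamma> P\<^sub>U \<Gamma>\<close> and \<open>\<Gamma> M\<close> is \<open>M\<^sup>\<perp>\<close> up to finite dimension, so is
  \<open>P\<^sub>M (1 - P\<^sub>U)\<close>, and \<open>P\<^sub>U - P\<^sub>M\<close> is their difference.
\<close>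

section \<open>Orthogonal projections in real Hilbert spaces\<close>

text \<open>Built on the inner product of the type alone, so that the scalars can be forgotten; on a
  \<open>lin_subspace\<close> it agrees with \<open>orth_proj\<close>. If \<open>U\<close> is a
  closed subspace of a complete space, the described point exists.\<close>

definition proj :: "'v::real_inner set \<Rightarrow> 'v \<Rightarrow> 'v" where
  "proj U x = (THE p. p \<in> U \<and> (\<forall>u\<in>U. inner (x - p) u = 0))"

text \<open>A minimising sequence is Cauchy by the parallelogram law: the midpoint of two of its
  terms lies in \<open>U\<close>, so its squared distance to \<open>x\<close> is at least the
  infimum.\<close>

lemma exists_nearest_point:
  fixes U :: "'v::{real_inner, complete_space} set"
  assumes U: "subspace U" "closed U"
  shows "\<exists>p\<in>U. \<forall>u\<in>U. (norm (x - p))\<^sup>2 \<le> (norm (x - u))\<^sup>2"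
proof -
  define A where "A = (\<lambda>u. (norm (x - u))\<^sup>2) ` U"
  define D where "D = Inf A"
  have bdd: "bdd_below A" unfolding A_def by (intro bdd_belowI2[where m=0]) auto
  have ne: "A \<noteq> {}" using subspace_0[OF U(1)] by (auto simp: A_def)
  have D_le: "D \<le> (norm (x - u))\<^sup>2" if "u \<in> U" for u
    unfolding D_def by (rule cInf_lower[OF _ bdd]) (use that in \<open>auto simp: A_def\<close>)
  have "\<exists>u\<in>U. (norm (x - u))\<^sup>2 < D + 1 / real (Suc n)" for n
  proof -
    have "Inf A < D + 1 / real (Suc n)" unfolding D_def by simp
    then show ?thesis using cInf_lessD[OF ne] by (auto simp: A_def)
  qed
  then obtain u where u: "\<And>n. u n \<in> U" "\<And>n. (norm (x - u n))\<^sup>2 < D + 1 / real (Suc n)"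
    by metis
  have est: "(norm (u m - u n))\<^sup>2 \<le> 2 / real (Suc m) + 2 / real (Suc n)" for m n
  proof -
    have mid: "(1/2) *\<^sub>R (u m + u n) \<in> U"
      using U u by (intro subspace_scale subspace_add) auto
    have "(norm (u m - u n))\<^sup>2 + 4 * (norm (x - (1/2) *\<^sub>R (u m + u n)))\<^sup>2
        = 2 * (norm (x - u m))\<^sup>2 + 2 * (norm (x - u n))\<^sup>2"
      by (simp add: power2_norm_eq_inner inner_diff_left inner_diff_right inner_add_left
          inner_add_right inner_commute algebra_simps)
    moreover have "2 / real (Suc m) = 2 * (1 / real (Suc m))" "2 / real (Suc n) = 2 * (1 / real (Suc n))"
      by simp_all
    ultimately show ?thesis using D_le[OF mid] u(2)[of m] u(2)[of n] by linarith
  qed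
  have "Cauchy u"
  proof (rule CauchyI)
    fix e :: real assume e: "e > 0"
    obtain N where N: "4 / real (Suc N) < e\<^sup>2"
    proof -
      obtain N where "4 / e\<^sup>2 < real N" using reals_Archimedean2 by blast
      then have "4 / e\<^sup>2 < real (Suc N)" by simp
      then have "4 / real (Suc N) < e\<^sup>2" using e by (simp add: field_simps)
      then show thesis using that by blast
    qed
    have "norm (u m - u n) < e" if "m \<ge> N" "n \<ge> N" for m n
    proof -
      have "2 / real (Suc m) \<le> 2 / real (Suc N)" "2 / real (Suc n) \<le> 2 / real (Suc N)"
        using that by (auto intro!: divide_left_mono)
      then have "(norm (u m - u n))\<^sup>2 < e\<^sup>2" using est[of m n] N by linarith
      then show ?thesis using e by (simp add: power_less_imp_less_base)
    qed
    then show "\<exists>M. \<forall>m\<ge>M. \<forall>n\<ge>M. norm (u m - u n) < e" by blast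
  qed
  then obtain p where p: "u \<longlonglongrightarrow> p" by (meson Cauchy_convergent convergentD)
  have pU: "p \<in> U" using closed_sequentially[OF U(2)] u(1) p by blast
  have "(\<lambda>n. (norm (x - u n))\<^sup>2) \<longlonglongrightarrow> (norm (x - p))\<^sup>2" by (intro tendsto_intros p)
  moreover have "(\<lambda>n. D + 1 / real (Suc n)) \<longlonglongrightarrow> D + 0"
    by (intro tendsto_intros LIMSEQ_inverse_real_of_nat[unfolded inverse_eq_divide])
  ultimately have "(norm (x - p))\<^sup>2 \<le> D"
    using LIMSEQ_le[of "\<lambda>n. (norm (x - u n))\<^sup>2" _ "\<lambda>n. D + 1 / real (Suc n)" D] u(2) less_imp_le
    by simp blast
  then show ?thesis using pU by (intro bexI[of _ p] ballI order_trans[OF _ D_le])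
qed

lemma exists_orthogonal_decomposition:
  fixes U :: "'v::{real_inner, complete_space} set"
  assumes U: "subspace U" "closed U"
  shows "\<exists>p\<in>U. \<forall>u\<in>U. inner (x - p) u = 0"
proof -
  obtain p where p: "p \<in> U" and min: "\<And>u. u \<in> U \<Longrightarrow> (norm (x - p))\<^sup>2 \<le> (norm (x - u))\<^sup>2"
    using exists_nearest_point[OF U] by blast
  have "inner (x - p) u = 0" if "u \<in> U" for u
  proof (cases "u = 0")
    case False
    \<comment> \<open>This \<open>t\<close> minimises the distance from \<open>x\<close> to
      \<open>p + t *\<^sub>R u\<close>; minimality of \<open>p\<close> makes the gain
      \<open>(inner (x - p) u)\<^sup>2 / inner u u\<close> nonpositive.\<close>
    define t where "t = inner (x - p) u / inner u u"
    have "p + t *\<^sub>R u \<in> U" using U p that by (intro subspace_add subspace_scale)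
    from min[OF this] have "(norm (x - p))\<^sup>2 \<le> (norm ((x - p) - t *\<^sub>R u))\<^sup>2"
      by (simp add: algebra_simps)
    also have "\<dots> = (norm (x - p))\<^sup>2 - 2 * t * inner (x - p) u + t * t * inner u u"
      unfolding power2_norm_eq_inner by (simp add: inner_diff_left inner_diff_right inner_commute algebra_simps)
    also have "\<dots> = (norm (x - p))\<^sup>2 - (inner (x - p) u)\<^sup>2 / inner u u"
      using False by (simp add: t_def power2_eq_square)
    finally have "(inner (x - p) u)\<^sup>2 / inner u u \<le> 0" by simp
    moreover have "inner u u > 0" using False by simp
    ultimately have "(inner (x - p) u)\<^sup>2 \<le> 0" by (metis divide_le_0_iff not_less)
    then show ?thesis by simp
  qed simp
  then show ?thesis using p by blast
qed

text \<open>Two candidates differ by an element of \<open>U\<close> that is orthogonal to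
  itself.\<close>

lemma proj_eqI:
  assumes U: "subspace U" and p: "p \<in> U" "\<And>u. u \<in> U \<Longrightarrow> inner (x - p) u = 0"
  shows "proj U x = p"
  unfolding proj_def
proof (rule the_equality)
  fix q assume q: "q \<in> U \<and> (\<forall>u\<in>U. inner (x - q) u = 0)"
  then have d: "q - p \<in> U" using p U by (simp add: subspace_diff)
  have "inner (q - p) (q - p) = inner (x - p) (q - p) - inner (x - q) (q - p)"
    by (simp add: inner_diff_left inner_diff_right)
  then show "q = p" using p(2) q d by simp
qed (use p in blast)

section \<open>Projections onto closed subspaces, their products and complements\<close>

locale closed_subspace =
  fixes U :: "'v::{real_inner, complete_space} set"
  assumes subspace: "subspace U" and closed: "closed U"
begin

lemma proj_in: "proj U x \<in> U"
  and proj_residual: "u \<in> U \<Longrightarrow> inner (x - proj U x) u = 0"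
proof -
  obtain p where "p \<in> U" "\<And>u. u \<in> U \<Longrightarrow> inner (x - p) u = 0"
    using exists_orthogonal_decomposition[OF subspace closed] by blast
  moreover from this have "proj U x = p" by (intro proj_eqI subspace)
  ultimately show "proj U x \<in> U" "u \<in> U \<Longrightarrow> inner (x - proj U x) u = 0" by auto
qed

lemma proj_id: "x \<in> U \<Longrightarrow> proj U x = x"
  by (intro proj_eqI subspace) auto

lemma proj_zero: "(\<And>u. u \<in> U \<Longrightarrow> inner x u = 0) \<Longrightarrow> proj U x = 0"
  by (intro proj_eqI subspace subspace_0) auto

lemma norm_proj_sq: "(norm x)\<^sup>2 = (norm (proj U x))\<^sup>2 + (norm (x - proj U x))\<^sup>2"
  using proj_residual[OF proj_in, of x x]
  by (simp add: power2_norm_eq_inner inner_diff_left inner_diff_right inner_commute)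

lemma norm_proj_le: "norm (proj U x) \<le> norm x"
proof (rule power2_le_imp_le)
  show "(norm (proj U x))\<^sup>2 \<le> (norm x)\<^sup>2" using norm_proj_sq[of x] zero_le_power2[of "norm (x - proj U x)"]
    by linarith
qed simp

lemma proj_add: "proj U (x + y) = proj U x + proj U y"
proof (intro proj_eqI subspace)
  show "inner (x + y - (proj U x + proj U y)) u = 0" if "u \<in> U" for u
    using proj_residual[OF that, of x] proj_residual[OF that, of y]
    by (simp add: inner_diff_left inner_add_left)
qed (simp add: proj_in subspace_add subspace)

lemma proj_scaleR: "proj U (r *\<^sub>R x) = r *\<^sub>R proj U x"
proof (intro proj_eqI subspace)
  show "inner (r *\<^sub>R x - r *\<^sub>R proj U x) u = 0" if "u \<in> U" for u
    using proj_residual[OF that, of x] by (simp add: inner_diff_left)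
qed (simp add: proj_in subspace_scale subspace)

lemma bounded_linear_proj: "bounded_linear (proj U)"
  by (rule bounded_linear_intro[where K=1]) (auto simp: proj_add proj_scaleR norm_proj_le)

lemma proj_self_adjoint: "inner (proj U x) y = inner x (proj U y)"
  using proj_residual[OF proj_in, of x y] proj_residual[OF proj_in, of y x]
  by (simp add: inner_diff_left inner_commute[of y] inner_commute[of "proj U y"])

end

lemma proj_Times:
  assumes "closed_subspace U" "closed_subspace W"
  shows "proj (U \<times> W) (x, y) = (proj U x, proj W y)"
proof (rule proj_eqI)
  show "subspace (U \<times> W)"
    using assms by (auto intro: subspace_Times simp: closed_subspace_def)
  show "(proj U x, proj W y) \<in> U \<times> W" using assms by (simp add: closed_subspace.proj_in)
  show "inner ((x, y) - (proj U x, proj W y)) u = 0" if "u \<in> U \<times> W" for u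
    using that assms by (cases u) (auto simp: inner_prod_def closed_subspace.proj_residual)
qed

lemma proj_compl:
  assumes U: "closed_subspace U"
  shows "proj {x. \<forall>u\<in>U. inner x u = 0} x = x - proj U x"
proof (rule proj_eqI)
  show "subspace {x. \<forall>u\<in>U. inner x u = 0}" by (auto simp: subspace_def inner_add_left)
  show "inner (x - (x - proj U x)) u = 0" if "u \<in> {x. \<forall>u\<in>U. inner x u = 0}" for u
    using that closed_subspace.proj_in[OF U, of x] by (simp add: inner_commute[of _ u])
qed (use U in \<open>auto simp: closed_subspace.proj_residual\<close>)

text \<open>An intersection of kernels of continuous functionals, for an arbitrary set
  \<open>U\<close>. Lagrangians and their composition are shown to be closed by bringing them into
  this form.\<close>

lemma closed_subspace_compl: "closed_subspace {x. \<forall>u\<in>U. inner x u = 0}"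
proof
  show "subspace {x. \<forall>u\<in>U. inner x u = 0}" by (auto simp: subspace_def inner_add_left)
  show "closed {x. \<forall>u\<in>U. inner x u = 0}"
    by (simp only: Ball_def imp_conv_disj) (intro closed_Collect_all closed_Collect_disj closed_Collect_const closed_Collect_eq continuous_intros)
qed

lemma closed_subspace_Times:
  "closed_subspace U \<Longrightarrow> closed_subspace W \<Longrightarrow> closed_subspace (U \<times> W)"
  by (auto simp: closed_subspace_def intro: subspace_Times closed_Times)

section \<open>Real Hilbert--Schmidt operators\<close>

definition orthonormal :: "'v::real_inner set \<Rightarrow> bool" where
  "orthonormal F \<longleftrightarrow> (\<forall>x\<in>F. \<forall>y\<in>F. inner x y = (if x = y then 1 else 0))"

lemma orthonormal_norm_sum:
  assumes "finite F" "orthonormal F"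
  shows "(norm (\<Sum>f\<in>F. c f *\<^sub>R f))\<^sup>2 = (\<Sum>f\<in>F. (c f)\<^sup>2)"
proof -
  have "(\<Sum>g\<in>F. c f * (c g * inner g f)) = (c f)\<^sup>2" if "f \<in> F" for f
  proof -
    have "(\<Sum>g\<in>F. c f * (c g * inner g f)) = (\<Sum>g\<in>F. if f = g then (c f)\<^sup>2 else 0)"
      using assms that by (intro sum.cong) (auto simp: orthonormal_def power2_eq_square)
    then show ?thesis using assms that by simp
  qed
  then show ?thesis
    by (simp add: power2_norm_eq_inner inner_sum_left inner_sum_right sum_distrib_left cong: sum.cong)
qed

text \<open>Serves where a quantity is bounded by a multiple of its own square root: divide by
  \<open>sqrt S\<close>.\<close>

lemma norm_le_of_sq_le_mult:
  assumes "(S::real) \<le> b * sqrt S" "0 \<le> S"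
  shows "S \<le> b\<^sup>2"
proof (cases "S = 0")
  case False
  then have s: "sqrt S > 0" using assms by simp
  have "sqrt S * sqrt S \<le> b * sqrt S" using assms by simp
  then have "sqrt S \<le> b" using s by (simp only: mult_le_cancel_right_pos)
  then have "(sqrt S)\<^sup>2 \<le> b\<^sup>2" using s by (intro power_mono) auto
  then show ?thesis using assms by simp
qed simp

text \<open>Phrased without the adjoint of \<open>A\<close>, so that no representation theorem is needed.\<close>

lemma bessel_bounded_linear:
  assumes F: "finite F" "orthonormal F" and A: "bounded_linear A" "\<And>x. norm (A x) \<le> C * norm x"
  shows "(\<Sum>f\<in>F. (inner (A f) y)\<^sup>2) \<le> (C * norm y)\<^sup>2"
proof -
  interpret A: bounded_linear A by (rule A)
  define S where "S = (\<Sum>f\<in>F. (inner (A f) y)\<^sup>2)"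
  \<comment> \<open>The adjoint image of \<open>y\<close>, projected to the span of
    \<open>F\<close>. Then \<open>S = inner (A z) y\<close> and \<open>norm z = sqrt S\<close>, so
    Cauchy-Schwarz bounds \<open>S\<close> by a multiple of \<open>sqrt S\<close>.\<close>
  define z where "z = (\<Sum>f\<in>F. inner (A f) y *\<^sub>R f)"
  have nz: "norm z = sqrt S"
    using orthonormal_norm_sum[OF F, of "\<lambda>f. inner (A f) y"]
    unfolding z_def[symmetric] S_def[symmetric] by (metis norm_ge_zero real_sqrt_unique)
  have "S = inner (A z) y"
    by (simp add: S_def z_def A.sum A.scaleR inner_sum_left power2_eq_square)
  also have "\<dots> \<le> norm (A z) * norm y" by (rule norm_cauchy_schwarz)
  also have "\<dots> \<le> (C * sqrt S) * norm y"
    using A(2)[of z] nz by (intro mult_right_mono) auto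
  finally have "S \<le> (C * norm y) * sqrt S" by (simp add: mult_ac)
  then have "S \<le> (C * norm y)\<^sup>2" by (rule norm_le_of_sq_le_mult) (simp add: S_def sum_nonneg)
  then show ?thesis by (simp add: S_def)
qed

lemma bessel_inequality:
  assumes "finite F" "orthonormal F"
  shows "(\<Sum>f\<in>F. (inner f y)\<^sup>2) \<le> (norm y)\<^sup>2"
  using bessel_bounded_linear[OF assms bounded_linear_ident, of 1 y] by simp

text \<open>Gram-Schmidt, recording expansions instead of spans. A new unit vector is orthogonal to
  the vectors already expanded, so their expansions persist.\<close>

lemma finite_orthonormal_expansion:
  assumes "finite A"
  shows "\<exists>G. finite G \<and> orthonormal G \<and> (\<forall>a\<in>A. a = (\<Sum>g\<in>G. inner a g *\<^sub>R g))"
  using assms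
proof (induction A)
  case empty
  then show ?case by (intro exI[of _ "{}"]) (simp add: orthonormal_def)
next
  case (insert a A)
  then obtain G where G: "finite G" "orthonormal G"
    and A: "\<And>x. x \<in> A \<Longrightarrow> x = (\<Sum>g\<in>G. inner x g *\<^sub>R g)" by blast
  define b where "b = a - (\<Sum>g\<in>G. inner a g *\<^sub>R g)"
  have b_orth: "inner b h = 0" if "h \<in> G" for h
  proof -
    have "(\<Sum>g\<in>G. inner a g * inner g h) = (\<Sum>g\<in>G. if g = h then inner a h else 0)"
      using G that by (intro sum.cong) (auto simp: orthonormal_def)
    then show ?thesis using G that by (simp add: b_def inner_diff_left inner_sum_left)
  qed
  show ?case
  proof (cases "b = 0")
    case True
    then have "a = (\<Sum>g\<in>G. inner a g *\<^sub>R g)" by (simp add: b_def)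
    then show ?thesis using G A by (intro exI[of _ G]) auto
  next
    case False
    define e where "e = b /\<^sub>R norm b"
    have e: "inner e e = 1" "\<And>h. h \<in> G \<Longrightarrow> inner e h = 0" "\<And>h. h \<in> G \<Longrightarrow> inner h e = 0"
      using False b_orth by (auto simp: e_def dot_square_norm power2_eq_square inner_commute field_simps)
    have eG: "e \<notin> G" using e by fastforce
    have "orthonormal (insert e G)" using G(2) e eG unfolding orthonormal_def by auto
    moreover have "x = (\<Sum>g\<in>insert e G. inner x g *\<^sub>R g)" if "x \<in> A" for x
    proof -
      have "inner x e = inner (\<Sum>g\<in>G. inner x g *\<^sub>R g) e" using A[OF that] by simp
      also have "\<dots> = 0" using e by (simp add: inner_sum_left)
      finally show ?thesis using A[OF that] G eG by simp
    qed
    moreover have "a = (\<Sum>g\<in>insert e G. inner a g *\<^sub>R g)"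
    proof -
      have ab: "a = b + (\<Sum>g\<in>G. inner a g *\<^sub>R g)" by (simp add: b_def)
      have "inner (\<Sum>g\<in>G. inner a g *\<^sub>R g) e = 0" using e by (simp add: inner_sum_left)
      then have "inner a e = inner b e" by (metis ab inner_add_left add.right_neutral)
      also have "\<dots> = norm b"
        using False by (simp add: e_def dot_square_norm power2_eq_square)
      finally have "inner a e *\<^sub>R e = b" using False by (simp add: e_def)
      then show ?thesis using ab G eG by simp
    qed
    ultimately show ?thesis using G(1) by (intro exI[of _ "insert e G"]) auto
  qed
qed

text \<open>
  Hilbert--Schmidt operators between real Hilbert spaces, described by finite orthonormal sets so
  that no orthonormal basis has to be chosen.
\<close>

definition real_hilbert_schmidt :: "('v::real_inner \<Rightarrow> 'w::real_inner) \<Rightarrow> bool" where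
  "real_hilbert_schmidt T \<longleftrightarrow>
     bounded_linear T \<and> (\<exists>M. \<forall>F. finite F \<longrightarrow> orthonormal F \<longrightarrow> (\<Sum>f\<in>F. (norm (T f))\<^sup>2) \<le> M)"

section \<open>Comparison, ideal property and smallness of Hilbert-Schmidt operators\<close>

lemma real_hilbert_schmidt_bounded_linear: "real_hilbert_schmidt T \<Longrightarrow> bounded_linear T"
  by (simp add: real_hilbert_schmidt_def)

text \<open>Rests on \<open>(s + r)\<^sup>2 \<le> 2 * s\<^sup>2 + 2 * r\<^sup>2\<close>. This
  pointwise comparison carries the final closeness proof.\<close>

lemma real_hilbert_schmidt_dominated:
  assumes "real_hilbert_schmidt S" "real_hilbert_schmidt R" "bounded_linear T"
    and dom: "\<And>x. norm (T x) \<le> norm (S x) + norm (R x)"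
  shows "real_hilbert_schmidt T"
proof -
  obtain M N where M: "\<And>F. finite F \<Longrightarrow> orthonormal F \<Longrightarrow> (\<Sum>f\<in>F. (norm (S f))\<^sup>2) \<le> M"
    and N: "\<And>F. finite F \<Longrightarrow> orthonormal F \<Longrightarrow> (\<Sum>f\<in>F. (norm (R f))\<^sup>2) \<le> N"
    using assms(1,2) unfolding real_hilbert_schmidt_def by metis
  have le: "(norm (T x))\<^sup>2 \<le> 2 * (norm (S x))\<^sup>2 + 2 * (norm (R x))\<^sup>2" for x
  proof -
    have "(norm (T x))\<^sup>2 \<le> (norm (S x) + norm (R x))\<^sup>2" by (intro power_mono dom) auto
    also have "\<dots> \<le> 2 * (norm (S x))\<^sup>2 + 2 * (norm (R x))\<^sup>2"
      using zero_le_power2[of "norm (S x) - norm (R x)"] unfolding power2_sum power2_diff by linarith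
    finally show ?thesis .
  qed
  have "(\<Sum>f\<in>F. (norm (T f))\<^sup>2) \<le> 2 * M + 2 * N" if "finite F" "orthonormal F" for F
  proof -
    have "(\<Sum>f\<in>F. (norm (T f))\<^sup>2) \<le> (\<Sum>f\<in>F. 2 * (norm (S f))\<^sup>2 + 2 * (norm (R f))\<^sup>2)"
      by (intro sum_mono le)
    also have "\<dots> = 2 * (\<Sum>f\<in>F. (norm (S f))\<^sup>2) + 2 * (\<Sum>f\<in>F. (norm (R f))\<^sup>2)"
      by (simp add: sum.distrib sum_distrib_left)
    finally show ?thesis using M[OF that] N[OF that] by linarith
  qed
  then show ?thesis using assms(3) unfolding real_hilbert_schmidt_def by blast
qed

lemma real_hilbert_schmidt_mono:
  assumes "real_hilbert_schmidt S" "bounded_linear T" "\<And>x. norm (T x) \<le> norm (S x)"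
  shows "real_hilbert_schmidt T"
proof (rule real_hilbert_schmidt_dominated[OF assms(1) assms(1) assms(2)])
  show "norm (T x) \<le> norm (S x) + norm (S x)" for x
    using assms(3)[of x] norm_ge_zero[of "S x"] by linarith
qed

lemma real_hilbert_schmidt_diff:
  assumes "real_hilbert_schmidt S" "real_hilbert_schmidt R"
  shows "real_hilbert_schmidt (\<lambda>x. S x - R x)"
  using assms
  by (rule real_hilbert_schmidt_dominated)
    (intro bounded_linear_sub real_hilbert_schmidt_bounded_linear assms norm_triangle_ineq4)+

text \<open>Expanding the vectors \<open>K (A f)\<close> in a finite orthonormal \<open>G\<close>
  and moving \<open>K\<close> across by self-adjointness gives a double sum; summing over
  \<open>F\<close> first, Bessel leaves \<open>C\<^sup>2\<close> times the sum for \<open>K\<close>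
  over \<open>G\<close>.\<close>

lemma real_hilbert_schmidt_compose:
  assumes K: "real_hilbert_schmidt K" "\<And>x y. inner (K x) y = inner x (K y)"
    and A: "bounded_linear A"
  shows "real_hilbert_schmidt (\<lambda>x. K (A x))"
proof -
  obtain M where M: "\<And>F. finite F \<Longrightarrow> orthonormal F \<Longrightarrow> (\<Sum>f\<in>F. (norm (K f))\<^sup>2) \<le> M"
    using K unfolding real_hilbert_schmidt_def by metis
  obtain C where C: "\<And>x. norm (A x) \<le> C * norm x"
    using bounded_linear.bounded[OF A] by (metis mult.commute)
  have "(\<Sum>f\<in>F. (norm (K (A f)))\<^sup>2) \<le> C\<^sup>2 * M" if F: "finite F" "orthonormal F" for F
  proof -
    obtain G where G: "finite G" "orthonormal G"
      and exp: "\<And>f. f \<in> F \<Longrightarrow> K (A f) = (\<Sum>g\<in>G. inner (K (A f)) g *\<^sub>R g)"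
      using finite_orthonormal_expansion[of "(\<lambda>f. K (A f)) ` F"] F by auto
    have "(norm (K (A f)))\<^sup>2 = (\<Sum>g\<in>G. (inner (A f) (K g))\<^sup>2)" if "f \<in> F" for f
      using orthonormal_norm_sum[OF G, of "\<lambda>g. inner (K (A f)) g"] exp[OF that] K(2) by simp
    then have "(\<Sum>f\<in>F. (norm (K (A f)))\<^sup>2) = (\<Sum>g\<in>G. \<Sum>f\<in>F. (inner (A f) (K g))\<^sup>2)"
      by (simp add: sum.swap[of _ G F])
    also have "\<dots> \<le> (\<Sum>g\<in>G. (C * norm (K g))\<^sup>2)"
      by (intro sum_mono bessel_bounded_linear F A C)
    also have "\<dots> = C\<^sup>2 * (\<Sum>g\<in>G. (norm (K g))\<^sup>2)"
      by (simp add: sum_distrib_left power_mult_distrib)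
    also have "\<dots> \<le> C\<^sup>2 * M" using M[OF G] by (intro mult_left_mono) auto
    finally show ?thesis .
  qed
  moreover have "bounded_linear (\<lambda>x. K (A x))"
    by (rule bounded_linear_compose[OF real_hilbert_schmidt_bounded_linear[OF K(1)] A])
  ultimately show ?thesis unfolding real_hilbert_schmidt_def by blast
qed

text \<open>Take \<open>F\<close> whose sum comes within \<open>e\<^sup>2\<close> of the supremum. A
  unit vector orthogonal to \<open>F\<close> enlarges the orthonormal set, so its image has squared
  norm at most \<open>e\<^sup>2\<close>.\<close>

lemma real_hilbert_schmidt_small:
  assumes K: "real_hilbert_schmidt K" and e: "e > 0"
  shows "\<exists>F. finite F \<and> (\<forall>x. (\<forall>f\<in>F. inner x f = 0) \<longrightarrow> norm (K x) \<le> e * norm x)"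
proof -
  interpret K: bounded_linear K by (rule real_hilbert_schmidt_bounded_linear[OF K])
  obtain M where M: "\<And>F. finite F \<Longrightarrow> orthonormal F \<Longrightarrow> (\<Sum>f\<in>F. (norm (K f))\<^sup>2) \<le> M"
    using K unfolding real_hilbert_schmidt_def by metis
  define A where "A = (\<lambda>F. \<Sum>f\<in>F. (norm (K f))\<^sup>2) ` {F. finite F \<and> orthonormal F}"
  have bdd: "bdd_above A" using M by (auto simp: A_def intro!: bdd_aboveI2)
  have ne: "A \<noteq> {}" unfolding A_def by (auto intro!: exI[of _ "{}"] simp: orthonormal_def)
  have "Sup A - e\<^sup>2 < Sup A" using e by simp
  then obtain F where F: "finite F" "orthonormal F" "Sup A - e\<^sup>2 < (\<Sum>f\<in>F. (norm (K f))\<^sup>2)"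
    unfolding less_cSup_iff[OF ne bdd] by (auto simp: A_def)
  have "norm (K x) \<le> e * norm x" if x: "\<And>f. f \<in> F \<Longrightarrow> inner x f = 0" for x
  proof (cases "x = 0")
    case False
    define g where "g = x /\<^sub>R norm x"
    have g: "inner g g = 1" "\<And>f. f \<in> F \<Longrightarrow> inner g f = 0" "\<And>f. f \<in> F \<Longrightarrow> inner f g = 0"
      using False x by (auto simp: g_def dot_square_norm power2_eq_square inner_commute field_simps)
    have gF: "g \<notin> F" using g by fastforce
    have "orthonormal (insert g F)" using F(2) g gF unfolding orthonormal_def by auto
    then have "(\<Sum>f\<in>insert g F. (norm (K f))\<^sup>2) \<le> Sup A"
      using F(1) bdd by (intro cSup_upper) (auto simp: A_def)
    then have "(norm (K g))\<^sup>2 \<le> e\<^sup>2" using F gF by simp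
    then have "norm (K g) \<le> e" by (rule power2_le_imp_le) (use e in simp)
    moreover have "norm (K g) = norm (K x) / norm x"
      by (simp add: g_def K.scaleR divide_inverse mult.commute)
    ultimately show ?thesis using False by (simp add: pos_divide_le_eq)
  qed simp
  then show ?thesis using F(1) by blast
qed

text \<open>The range has a fixed finite orthonormal frame \<open>G\<close>; self-adjointness and
  Bessel turn every sum over \<open>F\<close> into at most the sum over \<open>G\<close>.\<close>

lemma finite_rank_real_hilbert_schmidt:
  assumes P: "bounded_linear P" "\<And>x y. inner (P x) y = inner x (P y)"
    and H: "finite H" "\<And>x. P x \<in> span H"
  shows "real_hilbert_schmidt P"
proof -
  obtain G where G: "finite G" "orthonormal G"
    and exp: "\<And>h. h \<in> H \<Longrightarrow> h = (\<Sum>g\<in>G. inner h g *\<^sub>R g)"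
    using finite_orthonormal_expansion[OF H(1)] by auto
  have exp': "x = (\<Sum>g\<in>G. inner x g *\<^sub>R g)" if "x \<in> span H" for x
    using that
  proof (induction rule: span_induct_alt)
    case base
    then show ?case by simp
  next
    case (step c x y)
    have "(\<Sum>g\<in>G. inner (c *\<^sub>R x + y) g *\<^sub>R g)
        = c *\<^sub>R (\<Sum>g\<in>G. inner x g *\<^sub>R g) + (\<Sum>g\<in>G. inner y g *\<^sub>R g)"
      by (simp add: inner_add_left scaleR_add_left sum.distrib scaleR_sum_right)
    then show ?case using exp[OF step(1)] step(2) by simp
  qed
  have "(\<Sum>f\<in>F. (norm (P f))\<^sup>2) \<le> (\<Sum>g\<in>G. (norm (P g))\<^sup>2)" if F: "finite F" "orthonormal F" for F
  proof -
    have "(norm (P f))\<^sup>2 = (\<Sum>g\<in>G. (inner f (P g))\<^sup>2)" for f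
      using orthonormal_norm_sum[OF G, of "\<lambda>g. inner (P f) g"] exp'[OF H(2)[of f]] P(2) by simp
    then have "(\<Sum>f\<in>F. (norm (P f))\<^sup>2) = (\<Sum>g\<in>G. \<Sum>f\<in>F. (inner f (P g))\<^sup>2)"
      by (simp add: sum.swap[of _ G F])
    also have "\<dots> \<le> (\<Sum>g\<in>G. (norm (P g))\<^sup>2)"
      by (intro sum_mono bessel_inequality F)
    finally show ?thesis .
  qed
  then show ?thesis using P(1) unfolding real_hilbert_schmidt_def by blast
qed

section \<open>Closed ranges and bounded right inverses\<close>

lemma closed_image_of_section:
  assumes T: "bounded_linear T" and S: "bounded_linear S" and X: "closed X"
    and sec: "\<And>w. w \<in> T ` X \<Longrightarrow> S w \<in> X \<and> T (S w) = w"
  shows "closed (T ` X)"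
  unfolding closed_sequential_limits
proof (intro allI impI)
  fix s l assume s: "(\<forall>n. s n \<in> T ` X) \<and> s \<longlonglongrightarrow> l"
  \<comment> \<open>Continuity of the section supplies the preimage \<open>S l\<close> of the limit
    \<open>l\<close>.\<close>
  then have Sl: "(\<lambda>n. S (s n)) \<longlonglongrightarrow> S l" using bounded_linear.tendsto[OF S] by blast
  have "S (s n) \<in> X" for n using sec s by blast
  then have "S l \<in> X" using closed_sequentially[OF X _ Sl] by blast
  moreover have "s \<longlonglongrightarrow> T (S l)" using bounded_linear.tendsto[OF T Sl] sec s by simp
  then have "l = T (S l)" using s LIMSEQ_unique by blast
  ultimately show "l \<in> T ` X" by blast
qed

text \<open>
  The missing dimensions are added one at a time; the bounded right inverse is what keeps the range
  closed in each step.
\<close>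

lemma bounded_section:
  fixes T :: "'v::{real_inner, complete_space} \<Rightarrow> 'w::{real_inner, complete_space}"
  assumes T: "bounded_linear T" and "finite F"
    and "subspace X" "closed X"
    and "\<And>x. x \<in> X \<Longrightarrow> (\<forall>f\<in>F. inner x f = 0) \<Longrightarrow> norm x \<le> C * norm (T x)"
  shows "\<exists>S. bounded_linear S \<and> (\<forall>w\<in>T ` X. S w \<in> X \<and> T (S w) = w)"
  using assms(2-5)
proof (induction F arbitrary: X)
  case empty
  interpret T: bounded_linear T by (rule T)
  \<comment> \<open>Without constraints \<open>T\<close> is bounded below on all of
    \<open>X\<close>, hence injective there with closed range.\<close>
  have below: "norm x \<le> C * norm (T x)" if "x \<in> X" for x using empty(3) that by simp
  have sub: "subspace (T ` X)"
    using linear_subspace_image[OF T.linear empty(1)] .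
  have "\<exists>x\<in>X. w = T x" if lim: "s \<longlonglongrightarrow> w" and s: "\<And>n. s n \<in> T ` X" for s w
  proof -
    obtain x where x: "\<And>n. x n \<in> X" "\<And>n. s n = T (x n)" using s unfolding image_iff by metis
    have "Cauchy x"
    proof (rule CauchyI)
      fix e :: real assume e: "e > 0"
      have "Cauchy s" using lim LIMSEQ_imp_Cauchy by blast
      then obtain N where N: "\<And>m n. m \<ge> N \<Longrightarrow> n \<ge> N \<Longrightarrow> norm (s m - s n) < e / (\<bar>C\<bar> + 1)"
        using CauchyD[of s "e / (\<bar>C\<bar> + 1)"] e by auto
      have "norm (x m - x n) < e" if mn: "m \<ge> N" "n \<ge> N" for m n
      proof -
        have "norm (x m - x n) \<le> C * norm (s m - s n)"
          using below[of "x m - x n"] x empty(1) by (simp add: subspace_diff T.diff)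
        also have "\<dots> \<le> (\<bar>C\<bar> + 1) * norm (s m - s n)" by (intro mult_right_mono) auto
        also have "\<dots> < e" using N[OF mn] by (simp add: field_simps)
        finally show ?thesis .
      qed
      then show "\<exists>M. \<forall>m\<ge>M. \<forall>n\<ge>M. norm (x m - x n) < e" by blast
    qed
    then obtain y where y: "x \<longlonglongrightarrow> y" by (meson Cauchy_convergent convergentD)
    have "y \<in> X" using closed_sequentially[OF empty(2)] x(1) y by blast
    moreover have "s \<longlonglongrightarrow> T y" using T.tendsto[OF y] by (simp flip: x(2))
    ultimately show ?thesis using LIMSEQ_unique[OF lim] by blast
  qed
  then have "closed (T ` X)" unfolding closed_sequential_limits by blast
  then interpret R: closed_subspace "T ` X" using sub by unfold_locales
  interpret P: bounded_linear "proj (T ` X)" by (rule R.bounded_linear_proj)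
  have inj: "x = y" if "x \<in> X" "y \<in> X" "T x = T y" for x y
    using below[of "x - y"] that empty(1) by (simp add: subspace_diff T.diff)
  \<comment> \<open>The inverse of \<open>T\<close> on its range. Preceded by the projection onto
    that closed range it becomes defined everywhere.\<close>
  define I where "I = (\<lambda>w. SOME x. x \<in> X \<and> T x = w)"
  have I: "I w \<in> X" "T (I w) = w" if "w \<in> T ` X" for w
  proof -
    have "\<exists>x. x \<in> X \<and> T x = w" using that by auto
    then have "I w \<in> X \<and> T (I w) = w" unfolding I_def by (rule someI_ex)
    then show "I w \<in> X" "T (I w) = w" by auto
  qed
  define S where "S = (\<lambda>w. I (proj (T ` X) w))"
  have S: "S w \<in> X" "T (S w) = proj (T ` X) w" for w
    using I[OF R.proj_in] by (auto simp: S_def)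
  have "bounded_linear S"
  proof (rule bounded_linear_intro[where K="\<bar>C\<bar>"])
    show "S (x + y) = S x + S y" for x y
      by (rule inj) (auto simp: S T.add P.add subspace_add empty)
    show "S (r *\<^sub>R x) = r *\<^sub>R S x" for r x
      by (rule inj) (auto simp: S T.scaleR P.scaleR subspace_scale empty)
    show "norm (S x) \<le> norm x * \<bar>C\<bar>" for x
    proof -
      have "norm (S x) \<le> C * norm (proj (T ` X) x)" using below[OF S(1)] S(2) by simp
      also have "\<dots> \<le> \<bar>C\<bar> * norm x" using R.norm_proj_le by (intro mult_mono) auto
      finally show ?thesis by (simp add: mult.commute)
    qed
  qed
  then show ?case using S R.proj_id by (intro exI[of _ S]) auto
next
  case (insert f F)
  interpret T: bounded_linear T by (rule T)
  \<comment> \<open>The slice of \<open>X\<close> orthogonal to \<open>f\<close>, where only the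
    constraints in \<open>F\<close> remain. Outside the case \<open>Y = X\<close>, a single vector
    \<open>v\<close> spans \<open>X\<close> modulo \<open>Y\<close>.\<close>
  define Y where "Y = X \<inter> {x. inner x f = 0}"
  have Y: "subspace Y" "closed Y"
    using insert.prems unfolding Y_def
    by (auto simp: subspace_def inner_add_left intro!: closed_Int closed_Collect_eq continuous_intros)
  obtain S where "bounded_linear S" and S: "\<And>w. w \<in> T ` Y \<Longrightarrow> S w \<in> Y \<and> T (S w) = w"
    using insert.IH[OF Y] insert.prems(3) unfolding Y_def by auto
  interpret S: bounded_linear S by fact
  show ?case
  proof (cases "Y = X")
    case True
    then show ?thesis using S \<open>bounded_linear S\<close> by blast
  next
    case False
    then obtain v where v: "v \<in> X" "inner v f \<noteq> 0" by (auto simp: Y_def)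
    have split: "\<exists>y\<in>Y. \<exists>c. x = y + c *\<^sub>R v" if "x \<in> X" for x
    proof (intro bexI exI)
      show "x = (x - (inner x f / inner v f) *\<^sub>R v) + (inner x f / inner v f) *\<^sub>R v" by simp
      show "x - (inner x f / inner v f) *\<^sub>R v \<in> Y"
        using that v insert.prems(1) by (simp add: Y_def subspace_diff subspace_scale inner_diff_left)
    qed
    have sub: "subspace (T ` Y)" using linear_subspace_image[OF T.linear Y(1)] .
    have "closed (T ` Y)"
      using closed_image_of_section[OF T \<open>bounded_linear S\<close> Y(2)] S by blast
    then interpret R: closed_subspace "T ` Y" using sub by unfold_locales
    define q where "q = proj (T ` Y) (T v)"
    define p where "p = T v - q"
    have q: "q \<in> T ` Y" unfolding q_def by (rule R.proj_in)
    have p_orth: "inner p u = 0" if "u \<in> T ` Y" for u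
      unfolding p_def q_def by (rule R.proj_residual[OF that])
    define t where "t = (\<lambda>w. inner w p / inner p p)"
    define S' where "S' = (\<lambda>w. S (w - t w *\<^sub>R p) + t w *\<^sub>R (v - S q))"
    have "bounded_linear S'" unfolding S'_def t_def divide_inverse
      by (intro bounded_linear_add bounded_linear_compose[OF \<open>bounded_linear S\<close>] bounded_linear_sub
          bounded_linear_ident bounded_linear_scaleR_const bounded_linear_mult_const bounded_linear_inner_left)
    moreover have "S' (T x) \<in> X \<and> T (S' (T x)) = T x" if x: "x \<in> X" for x
    proof -
      obtain y c where y: "y \<in> Y" "x = y + c *\<^sub>R v" using split[OF x] by blast
      have Tx: "T x = (T y + c *\<^sub>R q) + c *\<^sub>R p" by (simp add: y T.add T.scaleR p_def algebra_simps)
      have u: "T y + c *\<^sub>R q \<in> T ` Y" using y q sub by (intro subspace_add subspace_scale) auto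
      have "inner (T y + c *\<^sub>R q) p = 0" using p_orth[OF u] by (simp only: inner_commute)
      \<comment> \<open>For \<open>p = 0\<close> the coefficient \<open>c\<close> cannot be
        recovered and \<open>t\<close> is 0 by the value of division by zero; the multiples of
        \<open>p\<close> agree nevertheless.\<close>
      then have c: "t (T x) *\<^sub>R p = c *\<^sub>R p" 
        by (cases "p = 0") (simp_all only: t_def Tx inner_add_left[of "T y + c *\<^sub>R q"], simp_all)
      have "S' (T x) = S (T y + c *\<^sub>R q) + t (T x) *\<^sub>R (v - S q)"
        unfolding S'_def c by (simp add: Tx)
      moreover have "S (T y + c *\<^sub>R q) \<in> Y" "T (S (T y + c *\<^sub>R q)) = T y + c *\<^sub>R q" "S q \<in> Y" "T (S q) = q"
        using S u q by auto
      moreover have "Y \<subseteq> X" by (auto simp: Y_def)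
      ultimately have "S' (T x) \<in> X" "T (S' (T x)) = T y + c *\<^sub>R q + t (T x) *\<^sub>R p"
        using v insert.prems(1) by (auto simp: T.add T.scaleR T.diff p_def
            intro!: subspace_add subspace_scale subspace_diff)
      then show ?thesis using c Tx by simp
    qed
    ultimately show ?thesis by blast
  qed
qed

section \<open>From scalars to reals\<close>

lemma conj_scalar_of_real: "conj_scalar (of_real r) = (of_real r :: 'k::real_or_complex)"
proof (cases "r = 0")
  case False
  have "(of_real r :: 'k) * conj_scalar (of_real r) = of_real r * of_real r"
    using mult_conj_scalar[of "of_real r :: 'k"]
    by (simp add: scaleR_conv_of_real power2_eq_square)
  then show ?thesis using False by simp
qed simp

lemma norm_conj_scalar: "norm (conj_scalar z) = norm (z :: 'k::real_or_complex)"
proof -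
  have "((norm (conj_scalar z))\<^sup>2 *\<^sub>R 1 :: 'k) = (norm z)\<^sup>2 *\<^sub>R 1"
    using mult_conj_scalar[of z] mult_conj_scalar[of "conj_scalar z"]
    by (simp add: conj_scalar_conj_scalar mult.commute)
  then show ?thesis by simp
qed

lemma conj_scalar_minus: "conj_scalar (- z) = - conj_scalar (z :: 'k::real_or_complex)"
  using conj_scalar_add[of z "- z"] by (simp add: eq_neg_iff_add_eq_0 add.commute)

lemma Re_scalar_eqI:
  "z + conj_scalar z = of_real (2 * r) \<Longrightarrow> Re_scalar (z :: 'k::real_or_complex) = r"
proof -
  assume "z + conj_scalar z = of_real (2 * r)"
  then have "(of_real (2 * Re_scalar z) :: 'k) = of_real (2 * r)"
    using add_conj_scalar[of z] by (simp only: scaleR_conv_of_real mult_1_right)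
  then show ?thesis unfolding of_real_eq_iff by simp
qed

lemma Re_scalar_of_real [simp]: "Re_scalar (of_real r :: 'k::real_or_complex) = r"
  by (rule Re_scalar_eqI) (simp add: conj_scalar_of_real)

lemma Re_scalar_0 [simp]: "Re_scalar (0 :: 'k::real_or_complex) = 0"
  using Re_scalar_of_real[of 0] by simp

text \<open>
  Here \<open>j\<close> is the imaginary unit if the scalars are complex and \<open>0\<close> if they are real.
\<close>

lemma imaginary_unit:
  obtains j :: "'k::real_or_complex" where "norm j \<le> 1"
    and "\<And>z :: 'k. z = of_real (Re_scalar z) - of_real (Re_scalar (j * z)) * j"
    and "\<And>z :: 'k. (norm z)\<^sup>2 = (Re_scalar z)\<^sup>2 + (Re_scalar (j * z))\<^sup>2"
proof (cases "\<forall>z :: 'k. conj_scalar z = z")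
  case True
  have z: "z = of_real (Re_scalar z)" for z :: 'k
    using add_conj_scalar[of z] True by (simp add: scaleR_conv_of_real flip: mult_2)
  have "norm z = \<bar>Re_scalar z\<bar>" for z :: 'k
    by (subst z) simp
  then show thesis using z by (intro that[of 0]) simp_all
next
  case False
  then obtain z0 :: 'k where z0: "conj_scalar z0 \<noteq> z0" by blast
  \<comment> \<open>Nonzero and negated by conjugation, so its normalisation \<open>j\<close>
    satisfies \<open>j * j = - 1\<close>.\<close>
  define w where "w = z0 - conj_scalar z0"
  have w: "w \<noteq> 0" using z0 by (simp add: w_def)
  have cw: "conj_scalar w = - w"
    using conj_scalar_add[of z0 "- conj_scalar z0"]
    by (simp add: w_def conj_scalar_minus conj_scalar_conj_scalar)
  define j where "j = w * of_real (inverse (norm w))"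
  have cj: "conj_scalar j = - j"
    by (simp only: j_def conj_scalar_mult cw conj_scalar_of_real mult_minus_left)
  have nj: "norm j = 1" using w by (simp add: j_def norm_mult norm_inverse)
  have jj: "j * j = - 1"
    using mult_conj_scalar[of j] nj cj by (simp add: minus_equation_iff)
  \<comment> \<open>Thus \<open>Re_scalar (j * z)\<close> is minus the imaginary part of
    \<open>z\<close> with respect to \<open>j\<close>.\<close>
  have Re_j: "of_real (2 * Re_scalar (j * z)) = j * (z - conj_scalar z)" for z
  proof -
    have "conj_scalar (j * z) = - (j * conj_scalar z)" by (simp add: conj_scalar_mult cj)
    then show ?thesis
      using add_conj_scalar[of "j * z"]
      by (simp only: scaleR_conv_of_real mult_1_right right_diff_distrib) simp
  qed
  have Re: "of_real (2 * Re_scalar z) = z + conj_scalar z" for z :: 'k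
    using add_conj_scalar[of z] by (simp add: scaleR_conv_of_real)
  have dec: "z = of_real (Re_scalar z) - of_real (Re_scalar (j * z)) * j" for z
  proof -
    have "2 * (of_real (Re_scalar z) - of_real (Re_scalar (j * z)) * j)
        = of_real (2 * Re_scalar z) - of_real (2 * Re_scalar (j * z)) * j"
      by (simp add: right_diff_distrib mult.assoc)
    also have "\<dots> = z + conj_scalar z - (j * j) * (z - conj_scalar z)"
      unfolding Re[of z] Re_j by (simp add: mult_ac)
    also have "\<dots> = 2 * z" by (simp add: jj)
    finally have "of_real (Re_scalar z) - of_real (Re_scalar (j * z)) * j = z"
      by (simp only: mult_cancel_left) simp
    then show ?thesis by simp
  qed
  have "(norm z)\<^sup>2 = (Re_scalar z)\<^sup>2 + (Re_scalar (j * z))\<^sup>2" for z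
  proof -
    define a b where "a = Re_scalar z" and "b = Re_scalar (j * z)"
    have z: "z = of_real a - of_real b * j" unfolding a_def b_def by (rule dec)
    have cz: "conj_scalar z = of_real a + of_real b * j"
      using conj_scalar_add[of "of_real a" "- (of_real b * j)"]
      by (simp add: z conj_scalar_minus conj_scalar_mult conj_scalar_of_real cj)
    have "of_real ((norm z)\<^sup>2) = z * conj_scalar z"
      by (simp add: mult_conj_scalar scaleR_conv_of_real)
    also have "\<dots> = of_real a * of_real a - of_real b * of_real b * (j * j)"
      unfolding cz by (subst z) (simp add: algebra_simps)
    also have "\<dots> = of_real (a\<^sup>2 + b\<^sup>2)" by (simp add: jj power2_eq_square)
    finally show ?thesis unfolding of_real_eq_iff a_def b_def .
  qed
  then show thesis using nj dec by (intro that[of j]) simp_all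
qed

section \<open>Scalar-valued inner products and the underlying real Hilbert space\<close>

locale hilbert =
  fixes V :: "('k::real_or_complex, 'v::{real_inner, complete_space}) super_space"
  assumes hilbert: "hilbert_space V"
begin

sublocale K: vector_space "scl V" by (rule hilbert_spaceD(1)[OF hilbert])

lemmas scl_of_real = hilbert_spaceD(2)[OF hilbert]
lemmas ip_add_left = hilbert_spaceD(3)[OF hilbert]
lemmas ip_scl_left = hilbert_spaceD(4)[OF hilbert]
lemmas ip_conj = hilbert_spaceD(5)[OF hilbert]
lemmas Re_ip = hilbert_spaceD(6)[OF hilbert]

lemma ip_add_right: "ip V x (y + z) = ip V x y + ip V x z"
  using ip_conj[of x] by (simp add: ip_add_left conj_scalar_add)

lemma ip_scl_right: "ip V x (scl V c y) = conj_scalar c * ip V x y"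
  using ip_conj[of x] by (simp add: ip_scl_left conj_scalar_mult)

lemma ip_zero_left [simp]: "ip V 0 x = 0"
  using ip_add_left[of 0 0 x] by simp

lemma ip_zero_right [simp]: "ip V x 0 = 0"
  using ip_add_right[of x 0 0] by simp

lemma ip_minus_left: "ip V (- x) y = - ip V x y"
  using ip_add_left[of x "- x" y] by (simp add: eq_neg_iff_add_eq_0 add.commute)

lemma ip_diff_left: "ip V (x - y) z = ip V x z - ip V y z"
  using ip_add_left[of x "- y" z] by (simp add: ip_minus_left)

lemma ip_sum_left: "ip V (sum f A) y = (\<Sum>a\<in>A. ip V (f a) y)"
  by (induction A rule: infinite_finite_induct) (auto simp: ip_add_left)

lemma ip_sum_right: "ip V y (sum f A) = (\<Sum>a\<in>A. ip V y (f a))"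
  by (induction A rule: infinite_finite_induct) (auto simp: ip_add_right)

lemma ip_self: "ip V x x = of_real ((norm x)\<^sup>2)"
proof -
  have "of_real (2 * Re_scalar (ip V x x)) = ip V x x + ip V x x"
    using add_conj_scalar[of "ip V x x"] ip_conj[of x x] by (simp add: scaleR_conv_of_real)
  then show ?thesis by (simp add: Re_ip power2_norm_eq_inner flip: mult_2)
qed

lemma norm_scl: "norm (scl V c x) = norm c * norm x"
proof -
  have "(of_real ((norm (scl V c x))\<^sup>2) :: 'k) = (c * conj_scalar c) * of_real ((norm x)\<^sup>2)"
    unfolding ip_self[symmetric] by (simp add: ip_scl_left ip_scl_right)
  also have "\<dots> = of_real ((norm c * norm x)\<^sup>2)"
    by (simp add: mult_conj_scalar scaleR_conv_of_real power_mult_distrib)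
  finally have "(norm (scl V c x))\<^sup>2 = (norm c * norm x)\<^sup>2" unfolding of_real_eq_iff .
  then show ?thesis by simp
qed

lemma real_subspace: "lin_subspace V U \<Longrightarrow> subspace U"
  unfolding lin_subspace_def subspace_def K.subspace_def by (metis scl_of_real)

lemma closed_subspaceI: "lin_subspace V U \<Longrightarrow> closed U \<Longrightarrow> closed_subspace U"
  by (simp add: closed_subspace_def real_subspace)

text \<open>\<open>U\<close> is closed under all scalars, so \<open>u\<close> may be replaced by
  \<open>scl V (ip V x u) u\<close>, whose real inner product with \<open>x\<close> is the squared
  norm of \<open>ip V x u\<close>.\<close>

lemma ip_zero_iff_inner_zero:
  assumes U: "lin_subspace V U"
  shows "(\<forall>u\<in>U. ip V x u = 0) \<longleftrightarrow> (\<forall>u\<in>U. inner x u = 0)"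
proof (intro iffI ballI)
  fix u assume *: "\<forall>u\<in>U. inner x u = 0" "u \<in> U"
  define c where "c = ip V x u"
  have "inner x (scl V c u) = Re_scalar (c * conj_scalar c)"
    using Re_ip[of x "scl V c u"] by (simp add: ip_scl_right c_def mult.commute)
  also have "\<dots> = (norm c)\<^sup>2" by (simp add: mult_conj_scalar scaleR_conv_of_real flip: of_real_power)
  finally show "ip V x u = 0" using * U by (simp add: c_def lin_subspace_def K.subspace_scale)
next
  fix u assume "\<forall>u\<in>U. ip V x u = 0" "u \<in> U"
  then show "inner x u = 0" using Re_ip[of x u] by simp
qed

lemma orth_compl_eq: "lin_subspace V U \<Longrightarrow> orth_compl V U = {x. \<forall>u\<in>U. inner x u = 0}"
  by (simp add: orth_compl_def ip_zero_iff_inner_zero)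

lemma lin_subspace_orth_compl: "lin_subspace V (orth_compl V U)"
  by (auto simp: orth_compl_def lin_subspace_def K.subspace_def ip_add_left ip_scl_left)

lemma orth_proj_eq: "lin_subspace V U \<Longrightarrow> orth_proj V U = proj U"
  by (simp add: fun_eq_iff orth_proj_def proj_def orth_compl_eq)

text \<open>The residual is orthogonal to \<open>U\<close> in the scalar sense, which survives
  multiplication by any scalar.\<close>

lemma proj_scl:
  assumes U: "lin_subspace V U" "closed U"
  shows "proj U (scl V c x) = scl V c (proj U x)"
proof -
  interpret U: closed_subspace U by (rule closed_subspaceI[OF U])
  show ?thesis
  proof (intro proj_eqI U.subspace)
    show "scl V c (proj U x) \<in> U" using U.proj_in U by (simp add: lin_subspace_def K.subspace_scale)
    have "ip V (x - proj U x) u = 0" if "u \<in> U" for u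
      using U.proj_residual ip_zero_iff_inner_zero[OF U(1)] that by blast
    then have "ip V (scl V c (x - proj U x)) u = 0" if "u \<in> U" for u
      using that by (simp add: ip_scl_left)
    then show "inner (scl V c x - scl V c (proj U x)) u = 0" if "u \<in> U" for u
      using that Re_ip[of "scl V c (x - proj U x)" u] by (simp add: K.scale_right_diff_distrib)
  qed
qed

lemma linear_proj_diff:
  assumes "lin_subspace V U" "closed U" "lin_subspace V W" "closed W"
  shows "Vector_Spaces.linear (scl V) (scl V) (\<lambda>x. proj U x - proj W x)"
  using closed_subspaceI[OF assms(1,2)] closed_subspaceI[OF assms(3,4)]
  by (simp add: Vector_Spaces.linear_iff K.vector_space_axioms closed_subspace.proj_add proj_scl assms
      K.scale_right_diff_distrib)

section \<open>Hilbert-Schmidt operators over the scalars and over the reals\<close>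

lemma parseval_approx:
  assumes E: "orthonormal_basis V E" and d: "d > 0"
  shows "\<exists>G. finite G \<and> G \<subseteq> E \<and> (\<forall>H. finite H \<longrightarrow> G \<subseteq> H \<longrightarrow> H \<subseteq> E \<longrightarrow>
    (norm x)\<^sup>2 \<le> (\<Sum>e\<in>H. (norm (ip V x e))\<^sup>2) + d)"
proof -
  have "x \<in> closure (K.span E)" using E by (simp add: orthonormal_basis_def lin_span_def)
  then obtain y where y: "y \<in> K.span E" "dist y x < sqrt d"
    using closure_approachable d by (metis real_sqrt_gt_0_iff)
  then obtain G r where G: "finite G" "G \<subseteq> E" "y = (\<Sum>a\<in>G. scl V (r a) a)"
    unfolding K.span_explicit by blast
  have "(norm x)\<^sup>2 \<le> (\<Sum>e\<in>H. (norm (ip V x e))\<^sup>2) + d" if H: "finite H" "G \<subseteq> H" "H \<subseteq> E" for H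
  proof -
    \<comment> \<open>The projection of \<open>x\<close> to the span of \<open>H\<close>. It is at
      least as close to \<open>x\<close> as \<open>y\<close>, which lies in the span of
      \<open>G \<subseteq> H\<close>, and its squared norm is the sum of squared
      coefficients.\<close>
    define p where "p = (\<Sum>e\<in>H. scl V (ip V x e) e)"
    have pe: "ip V p e = ip V x e" if "e \<in> H" for e
    proof -
      have "ip V p e = (\<Sum>f\<in>H. if f = e then ip V x e else 0)"
        unfolding p_def ip_sum_left using E that H(3)
        by (intro sum.cong) (auto simp: ip_scl_left orthonormal_basis_def subset_iff)
      then show ?thesis using that H by simp
    qed
    have orth: "ip V (x - p) e = 0" if "e \<in> H" for e using pe[OF that] by (simp add: ip_diff_left)
    have "ip V (x - p) p = 0" by (subst (2) p_def) (simp add: ip_sum_right ip_scl_right orth)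
    moreover have "ip V (x - p) y = 0"
      using G H by (auto simp: ip_sum_right ip_scl_right orth subset_iff intro!: sum.neutral)
    ultimately have o: "inner (x - p) p = 0" "inner (x - p) y = 0"
      using Re_ip[of "x - p"] by (metis Re_scalar_0)+
    have "ip V p p = (\<Sum>e\<in>H. conj_scalar (ip V x e) * ip V x e)"
      by (subst (2) p_def) (simp add: ip_sum_right ip_scl_right pe)
    also have "\<dots> = (\<Sum>e\<in>H. of_real ((norm (ip V x e))\<^sup>2))"
      by (simp add: mult.commute[of "conj_scalar _"] mult_conj_scalar scaleR_conv_of_real)
    finally have np: "(norm p)\<^sup>2 = (\<Sum>e\<in>H. (norm (ip V x e))\<^sup>2)"
      unfolding ip_self of_real_sum[symmetric] of_real_eq_iff .
    have "(norm (x - p))\<^sup>2 \<le> (norm (x - y))\<^sup>2"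
    proof -
      have "(norm (x - y))\<^sup>2 = (norm ((x - p) + (p - y)))\<^sup>2" by simp
      also have "\<dots> = (norm (x - p))\<^sup>2 + (norm (p - y))\<^sup>2"
        using o unfolding power2_norm_eq_inner
        by (simp only: inner_add_left inner_add_right inner_commute[of "p - y" "x - p"]
            inner_diff_right[of "x - p"])
      finally show ?thesis by simp
    qed
    moreover have "(norm (x - y))\<^sup>2 \<le> (sqrt d)\<^sup>2"
      using y(2) by (intro power_mono) (auto simp: dist_norm norm_minus_commute)
    moreover have "(norm x)\<^sup>2 = (norm (x - p))\<^sup>2 + (norm p)\<^sup>2"
      using o unfolding power2_norm_eq_inner by (simp add: inner_diff_left inner_diff_right inner_commute)
    moreover have "(sqrt d)\<^sup>2 = d" using d by simp
    ultimately show ?thesis using np by linarith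
  qed
  then show ?thesis using G by blast
qed

text \<open>
  For real orthonormal sets over complex scalars, splitting the scalar products into real and
  imaginary parts costs a factor of two.
\<close>

lemma hilbert_schmidt_imp_real:
  assumes T: "hilbert_schmidt V T" and adj: "\<And>x y. inner (T x) y = inner x (T y)"
  shows "real_hilbert_schmidt T"
proof -
  obtain E where E: "orthonormal_basis V E" and summ: "(\<lambda>e. (norm (T e))\<^sup>2) summable_on E"
    using T by (auto simp: hilbert_schmidt_def)
  have lin: "T (scl V c x) = scl V c (T x)" for c x
    using T by (simp add: hilbert_schmidt_def Vector_Spaces.linear_iff)
  define M where "M = infsum (\<lambda>e. (norm (T e))\<^sup>2) E"
  have M: "(\<Sum>e\<in>H. (norm (T e))\<^sup>2) \<le> M" if "finite H" "H \<subseteq> E" for H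
    unfolding M_def using that by (intro finite_sum_le_infsum summ) auto
  obtain j :: 'k where j: "norm j \<le> 1"
    and nj: "\<And>z :: 'k. (norm z)\<^sup>2 = (Re_scalar z)\<^sup>2 + (Re_scalar (j * z))\<^sup>2"
    by (rule imaginary_unit) blast
  have bessel: "(\<Sum>f\<in>F. (norm (ip V (T f) e))\<^sup>2) \<le> 2 * (norm (T e))\<^sup>2"
    if F: "finite F" "orthonormal F" for F e
  proof -
    \<comment> \<open>Multiplication by \<open>j\<close> moves into the second argument as
      \<open>conj_scalar j\<close>, so the imaginary part is again a real inner product of
      \<open>f\<close> with a fixed vector.\<close>
    have "(norm (ip V (T f) e))\<^sup>2 = (inner f (T e))\<^sup>2 + (inner f (scl V (conj_scalar j) (T e)))\<^sup>2" for f
    proof -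
      have "j * ip V (T f) e = ip V (T f) (scl V (conj_scalar j) e)"
        by (simp add: ip_scl_right conj_scalar_conj_scalar)
      then show ?thesis unfolding nj by (simp add: Re_ip adj lin)
    qed
    then have "(\<Sum>f\<in>F. (norm (ip V (T f) e))\<^sup>2)
        = (\<Sum>f\<in>F. (inner f (T e))\<^sup>2) + (\<Sum>f\<in>F. (inner f (scl V (conj_scalar j) (T e)))\<^sup>2)"
      by (simp add: sum.distrib)
    also have "\<dots> \<le> (norm (T e))\<^sup>2 + (norm (scl V (conj_scalar j) (T e)))\<^sup>2"
      by (intro add_mono bessel_inequality F)
    also have "(norm (scl V (conj_scalar j) (T e)))\<^sup>2 \<le> (norm (T e))\<^sup>2"
      using j by (intro power_mono) (auto simp: norm_scl norm_conj_scalar mult_left_le_one_le)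
    finally show ?thesis by simp
  qed
  have "(\<Sum>f\<in>F. (norm (T f))\<^sup>2) \<le> 2 * M" if F: "finite F" "orthonormal F" for F
  proof (rule field_le_epsilon)
    fix e :: real assume e: "e > 0"
    \<comment> \<open>The \<open>card F\<close> errors then add up to at most \<open>e\<close>; the
      \<open>+ 1\<close> covers empty \<open>F\<close>.\<close>
    define d where "d = e / (card F + 1)"
    have d: "d > 0" using e by (simp add: d_def)
    have "\<forall>f. \<exists>G. finite G \<and> G \<subseteq> E \<and> (\<forall>H. finite H \<longrightarrow> G \<subseteq> H \<longrightarrow> H \<subseteq> E \<longrightarrow>
        (norm (T f))\<^sup>2 \<le> (\<Sum>e\<in>H. (norm (ip V (T f) e))\<^sup>2) + d)"
      using parseval_approx[OF E d] by blast
    then obtain G where G: "\<And>f. finite (G f)" "\<And>f. G f \<subseteq> E"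
      "\<And>f H. finite H \<Longrightarrow> G f \<subseteq> H \<Longrightarrow> H \<subseteq> E \<Longrightarrow>
        (norm (T f))\<^sup>2 \<le> (\<Sum>e\<in>H. (norm (ip V (T f) e))\<^sup>2) + d" by metis
    \<comment> \<open>One finite part of the basis serving all \<open>f \<in> F\<close>, so that the
      sums over \<open>F\<close> and \<open>H\<close> can be interchanged.\<close>
    define H where "H = (\<Union>f\<in>F. G f)"
    have H: "finite H" "H \<subseteq> E" "\<And>f. f \<in> F \<Longrightarrow> G f \<subseteq> H" using G(1,2) F by (auto simp: H_def)
    have "(\<Sum>f\<in>F. (norm (T f))\<^sup>2) \<le> (\<Sum>f\<in>F. (\<Sum>e\<in>H. (norm (ip V (T f) e))\<^sup>2) + d)"
      using H by (intro sum_mono G(3)) auto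
    also have "\<dots> = (\<Sum>e\<in>H. \<Sum>f\<in>F. (norm (ip V (T f) e))\<^sup>2) + card F * d"
      by (simp add: sum.distrib sum.swap[of _ H F])
    also have "\<dots> \<le> (\<Sum>e\<in>H. 2 * (norm (T e))\<^sup>2) + e"
    proof (intro add_mono sum_mono bessel F)
      show "card F * d \<le> e" using e by (simp add: d_def field_simps)
    qed
    also have "(\<Sum>e\<in>H. 2 * (norm (T e))\<^sup>2) \<le> 2 * M"
      using M[OF H(1,2)] by (simp flip: sum_distrib_left)
    finally show "(\<Sum>f\<in>F. (norm (T f))\<^sup>2) \<le> 2 * M + e" by simp
  qed
  then show ?thesis using T unfolding real_hilbert_schmidt_def hilbert_schmidt_def by blast
qed

text \<open>Finite subsets of \<open>E\<close> are orthonormal for the real inner product too, so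
  their sums have a common bound.\<close>

lemma real_imp_hilbert_schmidt:
  assumes T: "real_hilbert_schmidt T" and "Vector_Spaces.linear (scl V) (scl V) T"
    and E: "orthonormal_basis V E"
  shows "hilbert_schmidt V T"
proof -
  obtain M where M: "\<And>F. finite F \<Longrightarrow> orthonormal F \<Longrightarrow> (\<Sum>f\<in>F. (norm (T f))\<^sup>2) \<le> M"
    using T unfolding real_hilbert_schmidt_def by metis
  have "orthonormal F" if "F \<subseteq> E" for F
  proof -
    have "inner x y = (if x = y then 1 else 0)" if "x \<in> F" "y \<in> F" for x y
    proof -
      have "ip V x y = of_real (if x = y then 1 else 0)"
        using E that \<open>F \<subseteq> E\<close> by (simp add: orthonormal_basis_def subset_iff)
      then show ?thesis using Re_ip[of x y] by (metis Re_scalar_of_real)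
    qed
    then show ?thesis by (simp add: orthonormal_def)
  qed
  then have "(\<lambda>e. (norm (T e))\<^sup>2) summable_on E"
    using M by (intro nonneg_bdd_above_summable_on bdd_aboveI2) auto
  then show ?thesis
    using assms real_hilbert_schmidt_bounded_linear[OF T] unfolding hilbert_schmidt_def by blast
qed

text \<open>Differences of projections are self-adjoint, as the passage to real operators requires.
  The basis contained in the definition of closeness is kept because \<open>closeI\<close> asks for
  one.\<close>

lemma closeD:
  assumes "close V U W"
  shows "closed_subspace U" "closed_subspace W" "real_hilbert_schmidt (\<lambda>x. proj U x - proj W x)"
    and "\<exists>E. orthonormal_basis V E"
proof -
  show cs: "closed_subspace U" "closed_subspace W"
    using assms by (auto simp: close_def closed_subspaceI)
  show "real_hilbert_schmidt (\<lambda>x. proj U x - proj W x)"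
  proof (rule hilbert_schmidt_imp_real)
    show "hilbert_schmidt V (\<lambda>x. proj U x - proj W x)"
      using assms by (auto simp: close_def orth_proj_eq)
    show "inner (proj U x - proj W x) y = inner x (proj U y - proj W y)" for x y
      using cs by (simp add: inner_diff_left inner_diff_right closed_subspace.proj_self_adjoint)
  qed
  show "\<exists>E. orthonormal_basis V E" using assms by (auto simp: close_def hilbert_schmidt_def)
qed

lemma closeI:
  assumes "lin_subspace V U" "closed U" "lin_subspace V W" "closed W"
    and "real_hilbert_schmidt (\<lambda>x. proj U x - proj W x)" "orthonormal_basis V E"
  shows "close V U W"
  using assms real_imp_hilbert_schmidt[OF assms(5) linear_proj_diff[OF assms(1-4)] assms(6)]
  by (simp add: close_def orth_proj_eq)

text \<open>As \<open>proj C\<close> kills \<open>A\<close>, its range is spanned by the images of a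
  finite complement. The scalar span of \<open>F\<close> lies in the real span of \<open>F\<close>
  and \<open>j F\<close>.\<close>

lemma finite_codim_proj:
  assumes A: "finite_codim V A" and C: "closed_subspace C"
    and zero: "\<And>a. a \<in> A \<Longrightarrow> proj C a = 0"
  shows "real_hilbert_schmidt (proj C)"
proof -
  interpret C: closed_subspace C by (rule C)
  interpret P: bounded_linear "proj C" by (rule C.bounded_linear_proj)
  obtain F where F: "finite F" "subspace_sum A (K.span F) = UNIV"
    using A by (auto simp: finite_codim_def lin_span_def)
  obtain j :: 'k where dec: "\<And>z :: 'k. z = of_real (Re_scalar z) - of_real (Re_scalar (j * z)) * j"
    by (rule imaginary_unit) blast
  define H where "H = F \<union> scl V j ` F"
  have scl_H: "scl V c f \<in> span H" if "f \<in> F" for c f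
  proof -
    have "scl V c f = Re_scalar c *\<^sub>R f - Re_scalar (j * c) *\<^sub>R scl V j f"
      by (subst dec[of c]) (simp add: K.scale_left_diff_distrib scl_of_real flip: K.scale_scale)
    moreover have "f \<in> span H" "scl V j f \<in> span H"
      using that by (auto simp: H_def intro: span_base)
    ultimately show ?thesis by (simp add: span_diff span_scale)
  qed
  have "K.span F \<subseteq> span H"
    unfolding K.span_explicit using scl_H by (auto intro!: span_sum)
  then have "proj C x \<in> span (proj C ` H)" for x
  proof -
    assume H: "K.span F \<subseteq> span H"
    have "x \<in> subspace_sum A (K.span F)" using F by simp
    then obtain a h where "a \<in> A" "h \<in> K.span F" "x = a + h" by (auto simp: subspace_sum_def)
    then have "proj C x = proj C h" "h \<in> span H"
      using zero H by (auto simp: P.add)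
    then show ?thesis by (simp add: linear_span_image[OF P.linear])
  qed
  then show ?thesis
    using F(1) C.proj_self_adjoint
    by (intro finite_rank_real_hilbert_schmidt[where H="proj C ` H"] P.bounded_linear_axioms)
      (auto simp: H_def)
qed

end

section \<open>Composition of real Lagrangian relations\<close>

locale grading_operator =
  fixes g :: "'v::{real_inner, complete_space} \<Rightarrow> 'v"
  assumes bounded_linear: "bounded_linear g"
    and involution [simp]: "g (g x) = x"
    and self_adjoint: "inner (g x) y = inner x (g y)"
begin

sublocale bounded_linear g by (rule bounded_linear)

lemma norm_grading [simp]: "norm (g x) = norm x"
  by (simp add: norm_eq_sqrt_inner self_adjoint)

text \<open>Isotropy makes \<open>g L\<close> orthogonal to \<open>L\<close>, so the projection of
  \<open>g x\<close> to \<open>L\<close> only sees the component of \<open>x\<close> orthogonal to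
  \<open>L\<close>.\<close>

lemma norm_proj_grading_le:
  assumes L: "closed_subspace L" and iso: "\<And>x y. x \<in> L \<Longrightarrow> y \<in> L \<Longrightarrow> inner (g x) y = 0"
  shows "norm (proj L (g x)) \<le> norm (x - proj L x)"
proof -
  interpret L: closed_subspace L by (rule L)
  define q where "q = proj L (g x)"
  have "inner q q = inner (g x) q"
    using L.proj_residual[of q "g x"] L.proj_in by (simp add: q_def inner_diff_left)
  also have "\<dots> = inner (x - proj L x) (g q)"
    using iso[OF L.proj_in L.proj_in, of x "g x"]
    by (simp add: inner_diff_left self_adjoint q_def)
  also have "\<dots> \<le> norm (x - proj L x) * norm q"
    using norm_cauchy_schwarz[of "x - proj L x" "g q"] by simp
  finally have "norm q * norm q \<le> norm (x - proj L x) * norm q"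
    by (simp add: dot_square_norm power2_eq_square)
  then show ?thesis unfolding q_def[symmetric] by (cases "q = 0") simp_all
qed

text \<open>
  For a Lagrangian \<open>L\<close> the last summand vanishes; for a sub-Lagrangian it has finite rank.
\<close>

lemma norm_proj_compl_grading_le:
  fixes L
  defines "C \<equiv> {x. \<forall>u\<in>L. inner x u = 0}" and "D \<equiv> {x. \<forall>u\<in>L \<union> g ` L. inner x u = 0}"
  assumes L: "closed_subspace L" and iso: "\<And>x y. x \<in> L \<Longrightarrow> y \<in> L \<Longrightarrow> inner (g x) y = 0"
  shows "norm (proj C (g x)) \<le> norm (x - proj C x) + norm (proj D x)"
proof -
  interpret L: closed_subspace L by (rule L)
  interpret C: closed_subspace C unfolding C_def by (rule closed_subspace_compl)
  interpret D: closed_subspace D unfolding D_def by (rule closed_subspace_compl)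
  define q where "q = proj C (g x)"
  \<comment> \<open>The part of \<open>g q\<close> orthogonal to \<open>L\<close>. Since
    \<open>q\<close> is orthogonal to \<open>L\<close> and \<open>L\<close> is isotropic, it is also
    orthogonal to \<open>g L\<close>.\<close>
  define s where "s = g q - proj L (g q)"
  have qC: "q \<in> C" by (simp add: q_def C.proj_in)
  have s: "s \<in> D"
  proof -
    have "inner s u = 0" if "u \<in> L" for u unfolding s_def by (rule L.proj_residual[OF that])
    moreover have "inner s (g u) = 0" if "u \<in> L" for u
    proof -
      have "inner (g q) (g u) = inner q u" by (simp add: self_adjoint)
      also have "\<dots> = 0" using qC that by (simp add: C_def)
      finally show ?thesis
        using iso[OF that L.proj_in, of "g q"]
        by (simp add: s_def inner_diff_left inner_commute[of "proj L _"])
    qed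
    ultimately show ?thesis by (auto simp: D_def)
  qed
  have ns: "norm s \<le> norm q"
    using L.norm_proj_sq[of "g q"] zero_le_power2[of "norm (proj L (g q))"]
    by (intro power2_le_imp_le[of "norm s"]) (auto simp: s_def)
  have "inner q q = inner x (g q)"
    using C.proj_residual[OF qC, of "g x"] by (simp add: q_def inner_diff_left self_adjoint)
  also have "\<dots> = inner x (proj L (g q)) + inner x s" by (simp add: s_def inner_diff_right)
  also have "inner x (proj L (g q)) = inner (proj L x) (g q)" by (simp add: L.proj_self_adjoint)
  also have "inner x s = inner (proj D x) s"
    using D.proj_residual[OF s, of x] by (simp add: inner_diff_left)
  also have "inner (proj L x) (g q) + inner (proj D x) s
      \<le> norm (proj L x) * norm q + norm (proj D x) * norm q"
    using norm_cauchy_schwarz[of "proj L x" "g q"] norm_cauchy_schwarz[of "proj D x" s]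
      mult_left_mono[OF ns, of "norm (proj D x)"] by simp
  finally have "norm q * norm q \<le> (norm (proj L x) + norm (proj D x)) * norm q"
    by (simp add: dot_square_norm power2_eq_square distrib_right)
  then have "norm q \<le> norm (proj L x) + norm (proj D x)" by (cases "q = 0") simp_all
  then show ?thesis unfolding q_def[symmetric] using proj_compl[OF L, of x] by (simp add: C_def)
qed

end

text \<open>
  The real data underlying two composable split Lagrangians, the Lagrangian condition being
  expressed as \<open>L = (\<Gamma> L)\<^sup>\<perp>\<close>.
\<close>

locale split_pair =
  g0: grading_operator g0 + g1: grading_operator g1 + g2: grading_operator g2
  for g0 :: "'a::{real_inner, complete_space} \<Rightarrow> 'a"
    and g1 :: "'b::{real_inner, complete_space} \<Rightarrow> 'b"
    and g2 :: "'c::{real_inner, complete_space} \<Rightarrow> 'c" +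
  fixes L01 :: "('a \<times> 'b) set" and L12 :: "('b \<times> 'c) set"
    and K0 :: "'a set" and K1 K1' :: "'b set" and K2 :: "'c set"
  assumes L01: "closed_subspace L01" and L12: "closed_subspace L12"
    and K0: "closed_subspace K0" and K1: "closed_subspace K1"
    and K1': "closed_subspace K1'" and K2: "closed_subspace K2"
    and lagr01: "L01 = {x. \<forall>y\<in>L01. inner (- g0 (fst x), g1 (snd x)) y = 0}"
    and lagr12: "L12 = {x. \<forall>y\<in>L12. inner (- g1 (fst x), g2 (snd x)) y = 0}"
    and iso0: "\<And>x y. x \<in> K0 \<Longrightarrow> y \<in> K0 \<Longrightarrow> inner (g0 x) y = 0"
    and iso2: "\<And>x y. x \<in> K2 \<Longrightarrow> y \<in> K2 \<Longrightarrow> inner (g2 x) y = 0"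
    and close01: "real_hilbert_schmidt
      (\<lambda>x. proj L01 x - proj ({x. \<forall>u\<in>K0. inner x u = 0} \<times> K1) x)"
    and close12: "real_hilbert_schmidt
      (\<lambda>x. proj L12 x - proj ({x. \<forall>u\<in>K1'. inner x u = 0} \<times> K2) x)"
    and close11: "real_hilbert_schmidt (\<lambda>x. proj K1 x - proj K1' x)"
    and defect0: "real_hilbert_schmidt (proj {x. \<forall>u\<in>K0 \<union> g0 ` K0. inner x u = 0})"
begin

section \<open>The comparison operators and the difference map \<open>D\<close>\<close>

definition "C0 = {x. \<forall>u\<in>K0. inner x u = 0}"
definition "T01 x = proj L01 x - proj (C0 \<times> K1) x"
definition "T12 x = proj L12 x - proj ({x. \<forall>u\<in>K1'. inner x u = 0} \<times> K2) x"
text \<open>The two splitness conditions may use different representatives \<open>K1\<close>,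
  \<open>K1'\<close> of the middle polarization; this operator measures their discrepancy.\<close>

definition "T11 x = proj K1 x - proj K1' x"
definition "D z = (fst (fst z), snd (fst z) - fst (snd z), snd (snd z))"
definition "G x = (- g0 (fst x), g2 (snd x))"
abbreviation "U \<equiv> L01 O L12"

lemma C0: "closed_subspace C0"
  unfolding C0_def by (rule closed_subspace_compl)

text \<open>On \<open>L01\<close> its own projection is the identity, so \<open>T01\<close> reads
  off the components orthogonal to \<open>C0\<close> and \<open>K1\<close>, the ones that splitness
  controls.\<close>

lemma T01_eq:
  assumes "x \<in> L01"
  shows "T01 x = (fst x - proj C0 (fst x), snd x - proj K1 (snd x))"
  using assms proj_Times[OF C0 K1, of "fst x" "snd x"]
  by (simp add: T01_def closed_subspace.proj_id[OF L01] minus_prod_def)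

lemma T12_eq:
  assumes "x \<in> L12"
  shows "T12 x = (proj K1' (fst x), snd x - proj K2 (snd x))"
  using assms proj_Times[OF closed_subspace_compl K2, of K1' "fst x" "snd x"]
  by (simp add: T12_def closed_subspace.proj_id[OF L12] minus_prod_def proj_compl[OF K1'])

lemma hs01: "real_hilbert_schmidt T01" and hs12: "real_hilbert_schmidt T12"
  and hs11: "real_hilbert_schmidt T11"
  using close01 close12 close11 by (simp_all add: T01_def[abs_def] T12_def[abs_def] T11_def[abs_def] C0_def)

lemma T01_self_adjoint: "inner (T01 x) y = inner x (T01 y)"
  by (simp add: T01_def inner_diff_left inner_diff_right closed_subspace.proj_self_adjoint L01
      closed_subspace_Times C0 K1)

lemma T12_self_adjoint: "inner (T12 x) y = inner x (T12 y)"
  by (simp add: T12_def inner_diff_left inner_diff_right closed_subspace.proj_self_adjoint L12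
      closed_subspace_Times closed_subspace_compl K2)

text \<open>\<open>T01\<close> controls the part of \<open>x1\<close> orthogonal to
  \<open>K1\<close>. The rest is \<open>proj K1 (x1 - y1) + proj K1' y1 + T11 y1\<close>, and
  \<open>T12\<close> controls \<open>proj K1' y1\<close>.\<close>

lemma middle_estimate:
  assumes "(x0, x1) \<in> L01" "(y1, x2) \<in> L12"
  shows "norm x1 \<le> norm (x1 - y1) + norm (T01 (x0, x1)) + norm (T12 (y1, x2)) + norm (T11 y1)"
proof -
  interpret P: bounded_linear "proj K1" by (rule closed_subspace.bounded_linear_proj[OF K1])
  have "norm x1 \<le> norm (x1 - proj K1 x1) + norm (proj K1 x1)"
    using norm_triangle_ineq[of "x1 - proj K1 x1" "proj K1 x1"] by simp
  also have "norm (x1 - proj K1 x1) \<le> norm (T01 (x0, x1))"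
    using T01_eq[OF assms(1)] by (simp add: norm_snd_le)
  also have "proj K1 x1 = proj K1 (x1 - y1) + proj K1' y1 + T11 y1"
    by (simp add: P.diff T11_def)
  also have "norm \<dots> \<le> norm (x1 - y1) + norm (T12 (y1, x2)) + norm (T11 y1)"
  proof (intro norm_triangle_le add_mono order_refl)
    show "norm (proj K1 (x1 - y1)) \<le> norm (x1 - y1)"
      by (rule closed_subspace.norm_proj_le[OF K1])
    show "norm (proj K1' y1) \<le> norm (T12 (y1, x2))"
      using T12_eq[OF assms(2)] by (simp add: norm_fst_le)
  qed
  finally show ?thesis by simp
qed

lemma bounded_linear_D: "bounded_linear D"
  unfolding D_def[abs_def]
  by (intro bounded_linear_Pair bounded_linear_sub bounded_linear_fst_comp bounded_linear_snd_comp
      bounded_linear_fst bounded_linear_snd)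

lemma D_bounded_below:
  "\<exists>F. finite F \<and> (\<forall>z\<in>L01 \<times> L12. (\<forall>f\<in>F. inner z f = 0) \<longrightarrow> norm z \<le> 11 * norm (D z))"
proof -
  \<comment> \<open>With \<open>d = norm (D z)\<close> the three small terms total at most
    \<open>(3 * norm x1 + 4 * d) / 8\<close>. Absorbing them gives
    \<open>norm x1 \<le> 12/5 * d\<close> and \<open>norm z \<le> 39/5 * d\<close>, within the
    constant 11.\<close>
  have e: "(1 / 8 :: real) > 0" by simp
  obtain F01 where F01: "finite F01"
    "\<And>x. (\<forall>f\<in>F01. inner x f = 0) \<Longrightarrow> norm (T01 x) \<le> 1 / 8 * norm x"
    using real_hilbert_schmidt_small[OF hs01 e] by blast
  obtain F12 where F12: "finite F12"
    "\<And>x. (\<forall>f\<in>F12. inner x f = 0) \<Longrightarrow> norm (T12 x) \<le> 1 / 8 * norm x"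
    using real_hilbert_schmidt_small[OF hs12 e] by blast
  obtain F11 where F11: "finite F11"
    "\<And>x. (\<forall>f\<in>F11. inner x f = 0) \<Longrightarrow> norm (T11 x) \<le> 1 / 8 * norm x"
    using real_hilbert_schmidt_small[OF hs11 e] by blast
  define F where "F = (\<lambda>f. (f, 0)) ` F01 \<union> (\<lambda>f. (0, f)) ` F12 \<union> (\<lambda>f. (0, (f, 0))) ` F11"
  have "norm z \<le> 11 * norm (D z)" if z: "z \<in> L01 \<times> L12" "\<And>f. f \<in> F \<Longrightarrow> inner z f = 0" for z
  proof -
    obtain x0 x1 y1 x2 where zz: "z = ((x0, x1), (y1, x2))" by (metis prod.collapse)
    have orth: "\<forall>f\<in>F01. inner (x0, x1) f = 0" "\<forall>f\<in>F12. inner (y1, x2) f = 0" "\<forall>f\<in>F11. inner y1 f = 0"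
      using z(2) unfolding F_def zz by (fastforce simp: inner_prod_def)+
    have "norm x1 \<le> norm (x1 - y1) + norm (T01 (x0, x1)) + norm (T12 (y1, x2)) + norm (T11 y1)"
      using z by (intro middle_estimate) (auto simp: zz)
    moreover have "norm (x0, x1) \<le> norm x0 + norm x1" "norm (y1, x2) \<le> norm y1 + norm x2"
      by (rule norm_Pair_le)+
    moreover have "norm y1 \<le> norm x1 + norm (x1 - y1)"
      using norm_triangle_ineq4[of x1 "x1 - y1"] by simp
    moreover have "norm z \<le> norm (x0, x1) + norm (y1, x2)" unfolding zz by (rule norm_Pair_le)
    moreover have "norm x0 \<le> norm (D z)" "norm (x1 - y1) \<le> norm (D z)" "norm x2 \<le> norm (D z)"
      by (auto simp: D_def zz norm_fst_le
          intro: norm_fst_le[THEN order_trans[OF _ norm_snd_le]] norm_snd_le[THEN order_trans[OF _ norm_snd_le]])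
    ultimately show ?thesis using F01(2)[OF orth(1)] F12(2)[OF orth(2)] F11(2)[OF orth(3)]
      norm_ge_zero[of "D z"] by linarith
  qed
  moreover have "finite F" using F01 F12 F11 by (simp add: F_def)
  ultimately show ?thesis by blast
qed

lemma bounded_section_D:
  "\<exists>S. bounded_linear S \<and> (\<forall>w\<in>D ` (L01 \<times> L12). S w \<in> L01 \<times> L12 \<and> D (S w) = w)"
proof -
  interpret L: closed_subspace "L01 \<times> L12" using L01 L12 by (rule closed_subspace_Times)
  show ?thesis
    using D_bounded_below bounded_section[OF bounded_linear_D _ L.subspace L.closed] by meson
qed

lemma closed_range_D: "closed_subspace (D ` (L01 \<times> L12))"
proof
  interpret L: closed_subspace "L01 \<times> L12" using L01 L12 by (rule closed_subspace_Times)
  show "subspace (D ` (L01 \<times> L12))"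
    by (rule linear_subspace_image[OF bounded_linear.linear[OF bounded_linear_D] L.subspace])
  show "closed (D ` (L01 \<times> L12))"
    using bounded_section_D closed_image_of_section[OF bounded_linear_D _ L.closed] by meson
qed

section \<open>The composition equals the annihilator of its image under \<open>G\<close>\<close>

lemma comp_iff: "x \<in> U \<longleftrightarrow> (fst x, 0, snd x) \<in> D ` (L01 \<times> L12)"
proof
  assume "x \<in> U"
  then obtain x1 where "(fst x, x1) \<in> L01" "(x1, snd x) \<in> L12" by auto
  then show "(fst x, 0, snd x) \<in> D ` (L01 \<times> L12)"
    by (intro image_eqI[where x="((fst x, x1), (x1, snd x))"]) (auto simp: D_def)
next
  assume "(fst x, 0, snd x) \<in> D ` (L01 \<times> L12)"
  then show "x \<in> U" by (cases x) (auto simp: D_def)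
qed

text \<open>
  If \<open>y\<close> annihilates \<open>U\<close>, then \<open>(y\<^sub>0, 0, y\<^sub>2)\<close> is orthogonal to the orthogonal complement of the
  range of \<open>D\<close>, because that complement is itself described by \<open>\<Gamma> L01\<close> and \<open>\<Gamma> L12\<close>.
\<close>

lemma annihilator_subset:
  assumes y: "\<And>x. x \<in> U \<Longrightarrow> inner (G y) x = 0"
  shows "y \<in> U"
proof -
  interpret R: closed_subspace "D ` (L01 \<times> L12)" by (rule closed_range_D)
  define v where "v = (fst y, 0 :: 'b, snd y)"
  \<comment> \<open>The residual of \<open>v\<close> against the closed range of \<open>D\<close>;
    the aim is \<open>w = 0\<close>.\<close>
  define w where "w = v - proj (D ` (L01 \<times> L12)) v"
  obtain w0 w1 w2 where ww: "w = (w0, w1, w2)" by (metis prod.collapse)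
  have orth: "inner w (D z) = 0" if "z \<in> L01 \<times> L12" for z
    unfolding w_def by (rule R.proj_residual) (use that in auto)
  have "(0, 0) \<in> L01" "(0, 0) \<in> L12"
    using L01 L12 subspace_0 by (auto simp: closed_subspace_def simp flip: zero_prod_def)
  then have o: "inner (w0, w1) z = 0" if "z \<in> L01" for z
    using orth[of "(z, (0, 0))"] that by (cases z) (simp add: D_def ww)
  have o': "inner (- w1, w2) z = 0" if "z \<in> L12" for z
    using orth[of "((0, 0), z)"] \<open>(0, 0) \<in> L01\<close> that by (cases z) (simp add: D_def ww)
  \<comment> \<open>The gradings carry the two orthogonality relations into \<open>L01\<close> and
    \<open>L12\<close>. Both resulting pairs have middle entry \<open>g1 w1\<close>, so they
    compose.\<close>
  have "(- g0 w0, g1 w1) \<in> L01" by (subst lagr01) (use o in \<open>simp add: g0.neg\<close>)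
  moreover have "(g1 w1, g2 w2) \<in> L12" by (subst lagr12) (use o' in simp)
  ultimately have "(- g0 w0, g2 w2) \<in> U" by auto
  from y[OF this] have "inner v w = 0"
    by (simp add: G_def v_def ww g0.self_adjoint g2.self_adjoint)
  moreover have "inner w (proj (D ` (L01 \<times> L12)) v) = 0"
    unfolding w_def by (intro R.proj_residual R.proj_in)
  ultimately have "inner w w = 0"
    by (subst (2) w_def) (simp add: inner_diff_right inner_commute)
  then have "v = proj (D ` (L01 \<times> L12)) v" by (simp add: w_def)
  then have "v \<in> D ` (L01 \<times> L12)" by (metis R.proj_in)
  then show ?thesis by (simp add: comp_iff v_def)
qed

text \<open>The two middle terms cancel, as the middle space enters \<open>L01\<close> and
  \<open>L12\<close> with opposite gradings.\<close>

lemma comp_isotropic: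
  assumes "x \<in> U" "y \<in> U"
  shows "inner (G x) y = 0"
proof -
  obtain x1 y1 where x: "(fst x, x1) \<in> L01" "(x1, snd x) \<in> L12"
    and y: "(fst y, y1) \<in> L01" "(y1, snd y) \<in> L12" using assms by auto
  have "inner (- g0 (fst x), g1 x1) (fst y, y1) = 0"
    using x(1) y(1) by (subst (asm) (1) lagr01) auto
  moreover have "inner (- g1 x1, g2 (snd x)) (y1, snd y) = 0"
    using x(2) y(2) by (subst (asm) (1) lagr12) auto
  ultimately show ?thesis by (cases y) (simp add: G_def)
qed

sublocale G: grading_operator G
proof (rule grading_operator.intro)
  show "bounded_linear G" unfolding G_def[abs_def]
    by (intro bounded_linear_Pair bounded_linear_minus
        bounded_linear_compose[OF g0.bounded_linear bounded_linear_fst]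
        bounded_linear_compose[OF g2.bounded_linear bounded_linear_snd])
  show "G (G x) = x" for x by (simp add: G_def g0.neg)
  show "inner (G x) y = inner x (G y)" for x y
    by (simp add: G_def inner_prod_def g0.self_adjoint g2.self_adjoint)
qed

lemma closed_subspace_comp: "closed_subspace U"
proof -
  have "U = {x. \<forall>u\<in>G ` U. inner x u = 0}"
  proof (intro set_eqI iffI CollectI ballI)
    show "inner x u = 0" if "x \<in> U" "u \<in> G ` U" for x u
      using that comp_isotropic[of x] by (auto simp only: G.self_adjoint)
    show "x \<in> U" if "x \<in> {x. \<forall>u\<in>G ` U. inner x u = 0}" for x
      by (rule annihilator_subset) (use that in \<open>simp only: G.self_adjoint, blast\<close>)
  qed
  then show ?thesis using closed_subspace_compl[of "G ` U"] by simp
qed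

text \<open>\<open>G\<close> interchanges \<open>U\<close> and its orthogonal complement. The
  identity yields both \<open>U + G U = UNIV\<close> and the second half of the closeness
  estimate.\<close>

lemma proj_comp_residual: "x - proj U x = G (proj U (G x))"
proof -
  interpret U: closed_subspace U by (rule closed_subspace_comp)
  have "proj U x = x - G (proj U (G x))"
  proof (rule proj_eqI[OF U.subspace])
    show "x - G (proj U (G x)) \<in> U"
      by (rule annihilator_subset) (simp add: G.diff U.proj_residual)
    show "inner (x - (x - G (proj U (G x)))) u = 0" if "u \<in> U" for u
      using comp_isotropic[OF U.proj_in that] by simp
  qed
  then show ?thesis by simp
qed

section \<open>Closeness of the composition to the product of \<open>C0\<close> and
  \<open>K2\<close>\<close>

lemma comp_close: "real_hilbert_schmidt (\<lambda>x. proj U x - proj (C0 \<times> K2) x)"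
proof -
  interpret U: closed_subspace U by (rule closed_subspace_comp)
  interpret M: closed_subspace "C0 \<times> K2" using C0 K2 by (rule closed_subspace_Times)
  interpret PU: bounded_linear "proj U" by (rule U.bounded_linear_proj)
  interpret PM: bounded_linear "proj (C0 \<times> K2)" by (rule M.bounded_linear_proj)
  obtain S where S: "bounded_linear S"
    "\<And>w. w \<in> D ` (L01 \<times> L12) \<Longrightarrow> S w \<in> L01 \<times> L12 \<and> D (S w) = w"
    using bounded_section_D by blast
  \<comment> \<open>For \<open>u \<in> U\<close> this is a pair in \<open>L01 \<times> L12\<close>
    with outer entries \<open>u\<close> and equal middle entries, depending boundedly and linearly
    on \<open>u\<close>.\<close>
  define A where "A w = S (fst w, 0, snd w)" for w
  have A: "bounded_linear A"
    unfolding A_def[abs_def]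
    by (intro bounded_linear_compose[OF S(1)] bounded_linear_Pair bounded_linear_fst
        bounded_linear_snd bounded_linear_zero)
  have est: "norm (fst u - proj C0 (fst u)) \<le> norm (T01 (fst (A u)))"
    "norm (snd u - proj K2 (snd u)) \<le> norm (T12 (snd (A u)))" if "u \<in> U" for u
  proof -
    have a: "A u \<in> L01 \<times> L12" "D (A u) = (fst u, 0, snd u)"
      using S(2) that comp_iff by (auto simp: A_def)
    then have "fst (A u) \<in> L01" "snd (A u) \<in> L12" "fst (fst (A u)) = fst u" "snd (snd (A u)) = snd u"
      by (auto simp: D_def)
    then show "norm (fst u - proj C0 (fst u)) \<le> norm (T01 (fst (A u)))"
      "norm (snd u - proj K2 (snd u)) \<le> norm (T12 (snd (A u)))"
      by (simp_all add: T01_eq T12_eq norm_fst_le norm_snd_le)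
  qed
  have hsA: "real_hilbert_schmidt (\<lambda>x. T01 (fst (A (B x))))" "real_hilbert_schmidt (\<lambda>x. T12 (snd (A (B x))))"
    if "bounded_linear B" for B :: "'a \<times> 'c \<Rightarrow> 'a \<times> 'c"
    using that
    by (auto intro!: real_hilbert_schmidt_compose[OF hs01 T01_self_adjoint]
        real_hilbert_schmidt_compose[OF hs12 T12_self_adjoint] bounded_linear_fst_comp
        bounded_linear_snd_comp bounded_linear_compose[OF A])
  \<comment> \<open>So \<open>x - proj U x = G (B x)\<close> with \<open>B x \<in> U\<close>, and
    \<open>est\<close> applies to \<open>B x\<close>.\<close>
  define B where "B x = proj U (G x)" for x
  have B: "bounded_linear B"
    unfolding B_def[abs_def] by (rule bounded_linear_compose[OF U.bounded_linear_proj G.bounded_linear])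
  have BU: "B x \<in> U" for x by (simp add: B_def U.proj_in)
  have "real_hilbert_schmidt (\<lambda>x. proj U x - proj (C0 \<times> K2) (proj U x))"
  proof (rule real_hilbert_schmidt_dominated[OF hsA(1) hsA(2)])
    fix x
    have "proj U x - proj (C0 \<times> K2) (proj U x) = (fst (proj U x) - proj C0 (fst (proj U x)),
        snd (proj U x) - proj K2 (snd (proj U x)))"
      using proj_Times[OF C0 K2, of "fst (proj U x)" "snd (proj U x)"] by (simp add: minus_prod_def)
    then show "norm (proj U x - proj (C0 \<times> K2) (proj U x))
        \<le> norm (T01 (fst (A (proj U x)))) + norm (T12 (snd (A (proj U x))))"
      using est[OF U.proj_in] by (smt (verit) norm_Pair_le)
  qed (auto intro!: bounded_linear_sub bounded_linear_compose[OF M.bounded_linear_proj]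
      U.bounded_linear_proj)
  moreover have "real_hilbert_schmidt (\<lambda>x. proj (C0 \<times> K2) (x - proj U x))"
  proof (rule real_hilbert_schmidt_dominated)
    \<comment> \<open>\<open>C0\<close> is the complement of the sub-Lagrangian \<open>K0\<close>,
      hence the estimate after \<open>g0\<close> leaves the projection to the defect space of
      \<open>K0\<close> as a second term.\<close>
    define Z where "Z = {x. \<forall>u\<in>K0 \<union> g0 ` K0. inner x u = 0}"
    have Z: "closed_subspace Z" unfolding Z_def by (rule closed_subspace_compl)
    show "real_hilbert_schmidt (\<lambda>x. proj C0 (g0 (fst (B x))))"
    proof (rule real_hilbert_schmidt_dominated[OF hsA(1)[OF B]])
      show "real_hilbert_schmidt (\<lambda>x. proj Z (fst (B x)))"
        by (rule real_hilbert_schmidt_compose[OF defect0[folded Z_def]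
              closed_subspace.proj_self_adjoint[OF Z] bounded_linear_fst_comp[OF B]])
      show "norm (proj C0 (g0 (fst (B x)))) \<le> norm (T01 (fst (A (B x)))) + norm (proj Z (fst (B x)))" for x
        using g0.norm_proj_compl_grading_le[OF K0 iso0, of "fst (B x)"] est(1)[OF BU, of x]
        unfolding C0_def Z_def by linarith
    qed (intro bounded_linear_compose[OF closed_subspace.bounded_linear_proj[OF C0]]
        bounded_linear_compose[OF g0.bounded_linear] bounded_linear_fst_comp B)
    \<comment> \<open>On the second factor isotropy of \<open>K2\<close> bounds the term by
      \<open>T12\<close> alone.\<close>
    show "real_hilbert_schmidt (\<lambda>x. proj K2 (g2 (snd (B x))))"
    proof (rule real_hilbert_schmidt_mono[OF hsA(2)[OF B]])
      show "norm (proj K2 (g2 (snd (B x)))) \<le> norm (T12 (snd (A (B x))))" for x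
        using g2.norm_proj_grading_le[OF K2 iso2] est(2)[OF BU] by (rule order_trans)
    qed (intro bounded_linear_compose[OF closed_subspace.bounded_linear_proj[OF K2]]
        bounded_linear_compose[OF g2.bounded_linear] bounded_linear_snd_comp B)
    show "bounded_linear (\<lambda>x. proj (C0 \<times> K2) (x - proj U x))"
      by (intro bounded_linear_compose[OF M.bounded_linear_proj] bounded_linear_sub
          bounded_linear_ident U.bounded_linear_proj)
    fix x
    interpret P0: bounded_linear "proj C0" by (rule closed_subspace.bounded_linear_proj[OF C0])
    have "proj (C0 \<times> K2) (x - proj U x) = (- proj C0 (g0 (fst (B x))), proj K2 (g2 (snd (B x))))"
    proof -
      have "x - proj U x = G (B x)" by (simp add: proj_comp_residual B_def)
      then show ?thesis by (simp add: G_def proj_Times[OF C0 K2] P0.neg)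
    qed
    then show "norm (proj (C0 \<times> K2) (x - proj U x))
        \<le> norm (proj C0 (g0 (fst (B x)))) + norm (proj K2 (g2 (snd (B x))))"
      using norm_Pair_le[of "- proj C0 (g0 (fst (B x)))" "proj K2 (g2 (snd (B x)))"] by simp
  qed
  \<comment> \<open>With \<open>P\<close>, \<open>Q\<close> the projections to \<open>U\<close> and
    \<open>C0 \<times> K2\<close>, this uses \<open>P - Q = (1 - Q) P - Q (1 - P)\<close>.\<close>
  ultimately have "real_hilbert_schmidt (\<lambda>x. (proj U x - proj (C0 \<times> K2) (proj U x))
      - proj (C0 \<times> K2) (x - proj U x))"
    by (rule real_hilbert_schmidt_diff)
  then show ?thesis by (simp add: PM.diff)
qed

end

section \<open>Composition of split Lagrangians\<close>

text \<open>Everything is read off the decomposition \<open>x = a + b\<close> into even and odd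
  parts, on which the grading is \<open>a - b\<close>.\<close>

lemma super_hilbert_spaceD:
  assumes "super_hilbert_space V"
  shows "hilbert V" and "grading_operator (grading V)"
proof -
  show "hilbert V" using assms by (simp add: hilbert_def super_hilbert_space_def)
  then interpret hilbert V .
  have dec: "\<exists>a\<in>even_part V. \<exists>b\<in>odd_part V. x = a + b" for x
  proof -
    have "x \<in> subspace_sum (even_part V) (odd_part V)"
      using assms by (simp add: super_hilbert_space_def)
    then show ?thesis unfolding subspace_sum_def by blast
  qed
  have g: "grading V (a + b) = a - b" if "a \<in> even_part V" "b \<in> odd_part V" for a b
    using assms that unfolding super_hilbert_space_def by blast
  have sub: "subspace (even_part V)" "subspace (odd_part V)"
    using assms by (auto simp: super_hilbert_space_def intro: real_subspace)
  have orth: "inner a b = 0" "inner b a = 0" if "a \<in> even_part V" "b \<in> odd_part V" for a b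
  proof -
    have "ip V a b = 0" using assms that unfolding super_hilbert_space_def by blast
    then show "inner a b = 0" using Re_ip[of a b] by simp
    then show "inner b a = 0" by (simp add: inner_commute)
  qed
  have inv: "grading V (grading V x) = x" for x
  proof -
    obtain a b where ab: "a \<in> even_part V" "b \<in> odd_part V" "x = a + b" using dec by blast
    then have "grading V (a + - b) = a - (- b)" using sub by (intro g) (auto intro: subspace_neg)
    then show ?thesis using ab g by simp
  qed
  have adj: "inner (grading V x) y = inner x (grading V y)" for x y
  proof -
    obtain a b where ab: "a \<in> even_part V" "b \<in> odd_part V" "x = a + b" using dec by blast
    obtain c d where cd: "c \<in> even_part V" "d \<in> odd_part V" "y = c + d" using dec by blast
    show ?thesis
      using ab cd orth by (simp add: g inner_diff_left inner_diff_right inner_add_left inner_add_right)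
  qed
  have "norm (grading V x) = norm x" for x by (simp add: norm_eq_sqrt_inner adj inv)
  moreover have "grading V (x + y) = grading V x + grading V y" for x y
  proof -
    obtain a b where ab: "a \<in> even_part V" "b \<in> odd_part V" "x = a + b" using dec by blast
    obtain c d where cd: "c \<in> even_part V" "d \<in> odd_part V" "y = c + d" using dec by blast
    have "grading V ((a + c) + (b + d)) = (a + c) - (b + d)"
      using ab cd sub by (intro g subspace_add) auto
    then show ?thesis using ab cd by (simp add: g algebra_simps)
  qed
  moreover have "grading V (r *\<^sub>R x) = r *\<^sub>R grading V x" for r x
  proof -
    obtain a b where ab: "a \<in> even_part V" "b \<in> odd_part V" "x = a + b" using dec by blast
    have "grading V (r *\<^sub>R a + r *\<^sub>R b) = r *\<^sub>R a - r *\<^sub>R b"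
      using ab sub by (intro g subspace_scale) auto
    then show ?thesis using ab by (simp add: g algebra_simps)
  qed
  ultimately have "bounded_linear (grading V)" by (intro bounded_linear_intro[where K=1]) auto
  then show "grading_operator (grading V)" using inv adj by (rule grading_operator.intro)
qed

lemma isotropic_inner:
  assumes "hilbert V" "isotropic V L" "x \<in> L" "y \<in> L"
  shows "inner (grading V x) y = 0"
  using assms hilbert.Re_ip[of V "grading V x" y] by (simp add: isotropic_def grading_form_def)

text \<open>Write \<open>x = l + grading V l'\<close>. If \<open>grading V x\<close> is orthogonal
  to \<open>L\<close>, pairing it with \<open>l'\<close> gives \<open>inner l' l' = 0\<close> by
  isotropy, so \<open>x = l\<close>. Closedness follows from this description.\<close>

lemma lagrangianD:
  assumes V: "super_hilbert_space V" and L: "lagrangian V L"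
  shows "L = {x. \<forall>y\<in>L. inner (grading V x) y = 0}" and "closed_subspace L"
proof -
  interpret hilbert V using super_hilbert_spaceD[OF V] by simp
  interpret g: grading_operator "grading V" using super_hilbert_spaceD[OF V] by simp
  have iso: "inner (grading V x) y = 0" if "x \<in> L" "y \<in> L" for x y
    using isotropic_inner[OF hilbert_axioms _ that] L by (simp add: lagrangian_def)
  have "x \<in> L" if x: "\<And>y. y \<in> L \<Longrightarrow> inner (grading V x) y = 0" for x
  proof -
    have "x \<in> subspace_sum L (grading V ` L)" using L by (simp add: lagrangian_def)
    then obtain l l' where l: "l \<in> L" "l' \<in> L" "x = l + grading V l'" by (auto simp: subspace_sum_def)
    have "inner l' l' = 0" using x[OF l(2)] iso[OF l(1,2)] by (simp add: l(3) g.add inner_add_left)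
    then show ?thesis using l by simp
  qed
  then show eq: "L = {x. \<forall>y\<in>L. inner (grading V x) y = 0}" using iso by auto
  then have "L = {x. \<forall>u\<in>grading V ` L. inner x u = 0}" by (simp add: g.self_adjoint)
  then show "closed_subspace L" using closed_subspace_compl[of "grading V ` L"] by simp
qed

section \<open>Subspaces and orthonormal bases of direct sums\<close>

lemma direct_sum_simps:
  "scl (direct_sum V W) c x = (scl V c (fst x), scl W c (snd x))"
  "ip (direct_sum V W) x y = ip V (fst x) (fst y) + ip W (snd x) (snd y)"
  "grading (direct_sum V W) x = (grading V (fst x), grading W (snd x))"
  by (simp_all add: direct_sum_def split_beta)

lemma parity_simps:
  "scl (parity V) = scl V" "ip (parity V) = ip V" "grading (parity V) x = - grading V x"
  by (simp_all add: parity_def)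

lemma lin_subspace_direct_sum_iff:
  assumes "hilbert V" "hilbert W"
  shows "lin_subspace (direct_sum V W) U \<longleftrightarrow> (0, 0) \<in> U \<and> (\<forall>x\<in>U. \<forall>y\<in>U. x + y \<in> U) \<and>
    (\<forall>c. \<forall>x\<in>U. (scl V c (fst x), scl W c (snd x)) \<in> U)"
proof -
  have "hilbert (direct_sum V W)" using assms by (simp add: hilbert_def hilbert_space_direct_sum)
  then interpret S: hilbert "direct_sum V W" .
  show ?thesis by (auto simp: lin_subspace_def S.K.subspace_def direct_sum_simps zero_prod_def)
qed

lemma lin_subspace_relcomp:
  assumes H: "hilbert V" "hilbert W" "hilbert Z"
    and L: "lin_subspace (direct_sum V W) L" and M: "lin_subspace (direct_sum W Z) M"
  shows "lin_subspace (direct_sum V Z) (L O M)"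
  unfolding lin_subspace_direct_sum_iff[OF H(1,3)]
proof (intro conjI ballI allI)
  note L = L[unfolded lin_subspace_direct_sum_iff[OF H(1,2)]]
    and M = M[unfolded lin_subspace_direct_sum_iff[OF H(2,3)]]
  show "(0, 0) \<in> L O M" using L M by blast
  fix x assume "x \<in> L O M"
  then obtain x1 where x: "(fst x, x1) \<in> L" "(x1, snd x) \<in> M" by auto
  show "(scl V c (fst x), scl Z c (snd x)) \<in> L O M" for c
    using L M x by (intro relcompI[where b="scl W c x1"]) force+
  fix y assume "y \<in> L O M"
  then obtain y1 where y: "(fst y, y1) \<in> L" "(y1, snd y) \<in> M" by auto
  have "(fst x, x1) + (fst y, y1) \<in> L" "(x1, snd x) + (y1, snd y) \<in> M" using L M x y by blast+
  then show "x + y \<in> L O M" by (cases x; cases y) auto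
qed

lemma orthonormal_basis_direct_sum:
  assumes H: "hilbert V" "hilbert W" and E: "orthonormal_basis V E" and F: "orthonormal_basis W F"
  shows "orthonormal_basis (direct_sum V W) ((\<lambda>e. (e, 0)) ` E \<union> Pair 0 ` F)"
proof -
  interpret V: hilbert V by fact
  interpret W: hilbert W by fact
  have "hilbert (direct_sum V W)" using H by (simp add: hilbert_def hilbert_space_direct_sum)
  then interpret S: hilbert "direct_sum V W" .
  let ?B = "(\<lambda>e. (e, 0)) ` E \<union> Pair 0 ` F"
  have left: "(x, 0) \<in> S.K.span ?B" if "x \<in> V.K.span E" for x
    using that
  proof (induction rule: V.K.span_induct_alt)
    case base
    then show ?case using S.K.span_zero by (simp add: zero_prod_def)
  next
    case (step c e x)
    have "(e, 0) \<in> S.K.span ?B" using step(1) by (intro S.K.span_base) auto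
    then have "scl (direct_sum V W) c (e, 0) + (x, 0) \<in> S.K.span ?B"
      using step(2) by (intro S.K.span_add S.K.span_scale)
    moreover have "scl (direct_sum V W) c (e, 0) + (x, 0) = (scl V c e + x, 0)"
      by (simp add: direct_sum_simps)
    ultimately show ?case by simp
  qed
  have right: "(0, y) \<in> S.K.span ?B" if "y \<in> W.K.span F" for y
    using that
  proof (induction rule: W.K.span_induct_alt)
    case base
    then show ?case using S.K.span_zero by (simp add: zero_prod_def)
  next
    case (step c e x)
    have "(0, e) \<in> S.K.span ?B" using step(1) by (intro S.K.span_base) auto
    then have "scl (direct_sum V W) c (0, e) + (0, x) \<in> S.K.span ?B"
      using step(2) by (intro S.K.span_add S.K.span_scale)
    moreover have "scl (direct_sum V W) c (0, e) + (0, x) = (0, scl W c e + x)"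
      by (simp add: direct_sum_simps)
    ultimately show ?case by simp
  qed
  have "V.K.span E \<times> W.K.span F \<subseteq> S.K.span ?B"
  proof
    fix z assume "z \<in> V.K.span E \<times> W.K.span F"
    then have "(fst z, 0) + (0, snd z) \<in> S.K.span ?B" using left right by (intro S.K.span_add) auto
    then show "z \<in> S.K.span ?B" by simp
  qed
  then have "closure (V.K.span E) \<times> closure (W.K.span F) \<subseteq> closure (S.K.span ?B)"
    using closure_mono closure_Times by metis
  then have "closure (lin_span (direct_sum V W) ?B) = UNIV"
    using E F by (auto simp: orthonormal_basis_def lin_span_def)
  moreover have "ip (direct_sum V W) e f = (if e = f then 1 else 0)" if "e \<in> ?B" "f \<in> ?B" for e f
  proof -
    \<comment> \<open>Basis vectors have square 1; excluding 0 keeps the two embedded families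
      disjoint.\<close>
    have "0 \<notin> E" "0 \<notin> F"
      using E F V.ip_zero_left[of 0] W.ip_zero_left[of 0] by (force simp: orthonormal_basis_def)+
    moreover have "ip V x y = (if x = y then 1 else 0)" if "x \<in> E" "y \<in> E" for x y
      using E that by (simp add: orthonormal_basis_def)
    moreover have "ip W x y = (if x = y then 1 else 0)" if "x \<in> F" "y \<in> F" for x y
      using F that by (simp add: orthonormal_basis_def)
    ultimately show ?thesis using that by (auto simp: direct_sum_simps split: if_split_asm)
  qed
  ultimately show ?thesis by (simp add: orthonormal_basis_def)
qed

section \<open>Transfer of polarized spaces to the real setting and back\<close>

theorem proposition3p5:
  fixes V\<^sub>0 :: "('k::real_or_complex, 'a::{real_inner, complete_space}) super_space"
    and V\<^sub>1 :: "('k, 'b::{real_inner, complete_space}) super_space"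
    and V\<^sub>2 :: "('k, 'c::{real_inner, complete_space}) super_space"
    and P\<^sub>0 :: "'a set set" and P\<^sub>1 :: "'b set set" and P\<^sub>2 :: "'c set set"
    and L\<^sub>0\<^sub>1 :: "('a \<times> 'b) set" and L\<^sub>1\<^sub>2 :: "('b \<times> 'c) set"
  assumes "polarized V\<^sub>0 P\<^sub>0" and "polarized V\<^sub>1 P\<^sub>1" and "polarized V\<^sub>2 P\<^sub>2"
    and "split_lagrangian V\<^sub>0 P\<^sub>0 V\<^sub>1 P\<^sub>1 L\<^sub>0\<^sub>1"
    and "split_lagrangian V\<^sub>1 P\<^sub>1 V\<^sub>2 P\<^sub>2 L\<^sub>1\<^sub>2"
  shows "lagrangian (direct_sum (parity V\<^sub>0) V\<^sub>2) (lagr_comp L\<^sub>1\<^sub>2 L\<^sub>0\<^sub>1) \<and>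
    split_lagrangian V\<^sub>0 P\<^sub>0 V\<^sub>2 P\<^sub>2 (lagr_comp L\<^sub>1\<^sub>2 L\<^sub>0\<^sub>1)"
proof -
  let ?W01 = "direct_sum (parity V\<^sub>0) V\<^sub>1" and ?W12 = "direct_sum (parity V\<^sub>1) V\<^sub>2"
    and ?W02 = "direct_sum (parity V\<^sub>0) V\<^sub>2"
  have V: "super_hilbert_space V\<^sub>0" "super_hilbert_space V\<^sub>1" "super_hilbert_space V\<^sub>2"
    using assms(1-3) by (auto simp: polarized_def)
  have W: "super_hilbert_space ?W01" "super_hilbert_space ?W12" "super_hilbert_space ?W02"
    using V by (auto intro: super_hilbert_space_direct_sum super_hilbert_space_parity)
  interpret V0: hilbert V\<^sub>0 by (rule super_hilbert_spaceD[OF V(1)])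
  interpret V1: hilbert V\<^sub>1 by (rule super_hilbert_spaceD[OF V(2)])
  interpret V2: hilbert V\<^sub>2 by (rule super_hilbert_spaceD[OF V(3)])
  interpret V0': hilbert "parity V\<^sub>0"
    by (rule super_hilbert_spaceD[OF super_hilbert_space_parity[OF V(1)]])
  interpret V1': hilbert "parity V\<^sub>1"
    by (rule super_hilbert_spaceD[OF super_hilbert_space_parity[OF V(2)]])
  interpret W01: hilbert ?W01 by (rule super_hilbert_spaceD[OF W(1)])
  interpret W12: hilbert ?W12 by (rule super_hilbert_spaceD[OF W(2)])
  interpret W02: hilbert ?W02 by (rule super_hilbert_spaceD[OF W(3)])
  obtain K0 K1 where K01: "K0 \<in> P\<^sub>0" "K1 \<in> P\<^sub>1" "close ?W01 L\<^sub>0\<^sub>1 (orth_compl V\<^sub>0 K0 \<times> K1)"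
    using assms(4) by (auto simp: split_lagrangian_def)
  obtain K1' K2 where K12: "K1' \<in> P\<^sub>1" "K2 \<in> P\<^sub>2" "close ?W12 L\<^sub>1\<^sub>2 (orth_compl V\<^sub>1 K1' \<times> K2)"
    using assms(5) by (auto simp: split_lagrangian_def)
  have L: "lagrangian ?W01 L\<^sub>0\<^sub>1" "lagrangian ?W12 L\<^sub>1\<^sub>2"
    using assms(4,5) by (auto simp: split_lagrangian_def)
  have sub: "sub_lagrangian V\<^sub>0 K0" "sub_lagrangian V\<^sub>1 K1" "sub_lagrangian V\<^sub>1 K1'" "sub_lagrangian V\<^sub>2 K2"
    using assms(1-3) K01 K12 by (auto simp: polarized_def)
  \<comment> \<open>Closeness within the polarization provides the orthonormal bases that the
    conclusion needs.\<close>
  obtain M0 where "close V\<^sub>0 M0 K0" using assms(1) K01 by (auto simp: polarized_def)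
  then obtain E0 where E0: "orthonormal_basis V\<^sub>0 E0" using V0.closeD by blast
  obtain M2 where "close V\<^sub>2 M2 K2" using assms(3) K12 by (auto simp: polarized_def)
  then obtain E2 where E2: "orthonormal_basis V\<^sub>2 E2" using V2.closeD by blast
  \<comment> \<open>\<open>K1\<close> and \<open>K1'\<close> are close to one common representative;
    subtracting the two differences compares them directly.\<close>
  obtain M1 where M1: "close V\<^sub>1 M1 K1" "close V\<^sub>1 M1 K1'"
    using assms(2) K01 K12 by (auto simp: polarized_def)
  have K1K1': "real_hilbert_schmidt (\<lambda>x. proj K1 x - proj K1' x)"
    using real_hilbert_schmidt_diff[OF V1.closeD(3)[OF M1(2)] V1.closeD(3)[OF M1(1)]] by simp
  have oc: "orth_compl V\<^sub>0 K0 = {x. \<forall>u\<in>K0. inner x u = 0}"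
    "orth_compl V\<^sub>1 K1' = {x. \<forall>u\<in>K1'. inner x u = 0}"
    using sub by (auto simp: sub_lagrangian_def V0.orth_compl_eq V1.orth_compl_eq)
  have defect: "real_hilbert_schmidt (proj {x. \<forall>u\<in>K0 \<union> grading V\<^sub>0 ` K0. inner x u = 0})"
  proof (rule V0.finite_codim_proj[OF _ closed_subspace_compl])
    show "finite_codim V\<^sub>0 (subspace_sum K0 (grading V\<^sub>0 ` K0))"
      using sub by (simp add: sub_lagrangian_def)
    show "proj {x. \<forall>u\<in>K0 \<union> grading V\<^sub>0 ` K0. inner x u = 0} a = 0"
      if "a \<in> subspace_sum K0 (grading V\<^sub>0 ` K0)" for a
      by (rule closed_subspace.proj_zero[OF closed_subspace_compl])
        (use that in \<open>auto simp: subspace_sum_def inner_commute[of _ "_ :: 'a"] inner_add_right inner_add_left\<close>)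
  qed
  interpret split_pair "grading V\<^sub>0" "grading V\<^sub>1" "grading V\<^sub>2" L\<^sub>0\<^sub>1 L\<^sub>1\<^sub>2 K0 K1 K1' K2
  proof (intro split_pair.intro split_pair_axioms.intro super_hilbert_spaceD V)
    show "closed_subspace L\<^sub>0\<^sub>1" "closed_subspace L\<^sub>1\<^sub>2" using lagrangianD W L by blast+
    show "closed_subspace K0" "closed_subspace K1" "closed_subspace K1'" "closed_subspace K2"
      using sub by (auto simp: sub_lagrangian_def intro: V0.closed_subspaceI V1.closed_subspaceI
          V2.closed_subspaceI)
    show "L\<^sub>0\<^sub>1 = {x. \<forall>y\<in>L\<^sub>0\<^sub>1. inner (- grading V\<^sub>0 (fst x), grading V\<^sub>1 (snd x)) y = 0}"
      using lagrangianD(1)[OF W(1) L(1)] by (simp add: direct_sum_simps parity_simps)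
    show "L\<^sub>1\<^sub>2 = {x. \<forall>y\<in>L\<^sub>1\<^sub>2. inner (- grading V\<^sub>1 (fst x), grading V\<^sub>2 (snd x)) y = 0}"
      using lagrangianD(1)[OF W(2) L(2)] by (simp add: direct_sum_simps parity_simps)
    show "inner (grading V\<^sub>0 x) y = 0" if "x \<in> K0" "y \<in> K0" for x y
      using isotropic_inner[OF V0.hilbert_axioms _ that] sub by (simp add: sub_lagrangian_def)
    show "inner (grading V\<^sub>2 x) y = 0" if "x \<in> K2" "y \<in> K2" for x y
      using isotropic_inner[OF V2.hilbert_axioms _ that] sub by (simp add: sub_lagrangian_def)
    show "real_hilbert_schmidt (\<lambda>x. proj L\<^sub>0\<^sub>1 x - proj ({x. \<forall>u\<in>K0. inner x u = 0} \<times> K1) x)"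
      using W01.closeD(3)[OF K01(3)] by (simp add: oc)
    show "real_hilbert_schmidt (\<lambda>x. proj L\<^sub>1\<^sub>2 x - proj ({x. \<forall>u\<in>K1'. inner x u = 0} \<times> K2) x)"
      using W12.closeD(3)[OF K12(3)] by (simp add: oc)
  qed (rule K1K1' defect)+
  define U' where "U' = lagr_comp L\<^sub>1\<^sub>2 L\<^sub>0\<^sub>1"
  have U': "U' = U" by (simp add: U'_def lagr_comp_def)
  have G: "grading ?W02 = G" by (simp add: fun_eq_iff G_def direct_sum_simps parity_simps)
  have lin: "lin_subspace ?W02 U"
  proof (rule lin_subspace_relcomp[OF V0'.hilbert_axioms V1.hilbert_axioms V2.hilbert_axioms])
    show "lin_subspace ?W01 L\<^sub>0\<^sub>1" using L by (simp add: lagrangian_def)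
    \<comment> \<open>Parity changes only the grading, so linearity also holds over
      \<open>direct_sum V\<^sub>1 V\<^sub>2\<close>.\<close>
    have "lin_subspace ?W12 L\<^sub>1\<^sub>2" using L by (simp add: lagrangian_def)
    then show "lin_subspace (direct_sum V\<^sub>1 V\<^sub>2) L\<^sub>1\<^sub>2"
      by (simp add: lin_subspace_def direct_sum_def parity_simps)
  qed
  have lagr: "lagrangian ?W02 U"
    unfolding lagrangian_def isotropic_def grading_form_def G
  proof (intro conjI lin ballI)
    \<comment> \<open>Real isotropy against the whole scalar subspace \<open>U\<close> upgrades to
      scalar isotropy.\<close>
    show "ip ?W02 (G x) y = 0" if "x \<in> U" "y \<in> U" for x y
      using W02.ip_zero_iff_inner_zero[OF lin, of "G x"] comp_isotropic[OF that(1)] that(2) by blast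
    have "x \<in> subspace_sum U (G ` U)" for x
    proof -
      have "x = proj U x + G (proj U (G x))" using proj_comp_residual[of x]
        by (simp add: diff_eq_eq add.commute)
      moreover have "proj U x \<in> U" "proj U (G x) \<in> U"
        by (rule closed_subspace.proj_in[OF closed_subspace_comp])+
      ultimately show ?thesis unfolding subspace_sum_def mem_Collect_eq
        by (intro exI[of _ "proj U x"] exI[of _ "G (proj U (G x))"] conjI imageI)
    qed
    then show "subspace_sum U (G ` U) = UNIV" by blast
  qed
  \<comment> \<open>The outer representatives \<open>K0\<close> and \<open>K2\<close> from the given
    splittings also witness the new one.\<close>
  have "close ?W02 U (orth_compl V\<^sub>0 K0 \<times> K2)"
  proof (rule W02.closeI[OF lin])
    show "closed U" using closed_subspace_comp by (simp add: closed_subspace_def)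
    show "closed (orth_compl V\<^sub>0 K0 \<times> K2)"
      using closed_subspace_Times[OF C0 K2] by (simp add: closed_subspace_def oc C0_def)
    have "lin_subspace V\<^sub>0 (orth_compl V\<^sub>0 K0)" "lin_subspace V\<^sub>2 K2"
      using V0.lin_subspace_orth_compl sub by (auto simp: sub_lagrangian_def)
    then show "lin_subspace ?W02 (orth_compl V\<^sub>0 K0 \<times> K2)"
      unfolding lin_subspace_direct_sum_iff[OF V0'.hilbert_axioms V2.hilbert_axioms]
      by (auto simp: lin_subspace_def V0.K.subspace_def V2.K.subspace_def parity_simps)
    show "real_hilbert_schmidt (\<lambda>x. proj U x - proj (orth_compl V\<^sub>0 K0 \<times> K2) x)"
      using comp_close by (simp add: oc C0_def)
    have "orthonormal_basis (parity V\<^sub>0) E0"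
      using E0 by (simp add: orthonormal_basis_def lin_span_def parity_simps)
    then show "orthonormal_basis ?W02 ((\<lambda>e. (e, 0)) ` E0 \<union> Pair 0 ` E2)"
      using E2 by (rule orthonormal_basis_direct_sum[OF V0'.hilbert_axioms V2.hilbert_axioms])
  qed
  then show ?thesis
    using lagr K01(1) K12(2) U' unfolding U'_def split_lagrangian_def by auto
qed

end
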